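(* Let $N$ be a nonnegative integer and let $t,b,c,d_1,d_2,e,f,\sigma,\beta,\gamma,\delta_1,\delta_2,\epsilon,\phi$ be nonzero complex numbers, generic in the sense that no denominator below vanishes, such that $$t^3\sigma^3q^{N+4}=b\,c\,d_1d_2\,e f\,\beta\gamma\delta_1\delta_2\epsilon\phi .$$ Then $$\sum_{K=0}^{N}\frac{(b/t,\ c/t,\ d_1/t,\ d_2/t,\ \sigma q,\ \epsilon,\ \phi,\ q^{-N})_K}{(q,\ 1/t,\ q/e,\ q/f,\ \sigma q/\beta,\ \sigma q/\gamma,\ \sigma q/\delta_1,\ \sigma q/\delta_2)_K}\,q^K$$ $$\times\ {}_{10}W_9\left[tq^{-K};\,b,c,d_1,d_2,eq^{-K},fq^{-K},q^{-K};\,q;\,\frac{t^3q^3}{bcd_1d_2ef}\right]$$ $$\times\ {}_{10}W_9\left[\sigma q^K;\,\beta,\gamma,\delta_1,\delta_2,\epsilon q^K,\phi q^K,q^{K-N};\,q;\,\frac{\sigma^3q^{N+3}}{\beta\gamma\delta_1\delta_2\epsilon\phi}\right]$$ $$=\phi^N\,\frac{(\sigma q/(\delta_1\phi),\ \sigma q/(\delta_2\phi),\ \epsilon,\ \sigma q/(\gamma\phi),\ \sigma q,\ \sigma q/(\beta\phi))_N}{(\sigma q/\delta_1,\ \sigma q/\delta_2,\ \epsilon/\phi,\ \sigma q/\gamma,\ \sigma q/\phi,\ \sigma q/\beta)_N}$$ $$\times\sum_{L=0}^{N}\frac{(tq/(cf),\ tq/(bf),\ tq/(d_1f),\ tq/(d_2f),\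 q^{1-N}\phi/\epsilon,\ q^{-N}\phi/\sigma,\ \phi,\ q^{-N})_L}{(q,\ e/f,\ tq/f,\ q/f,\ q^{-N}\gamma\phi/\sigma,\ q^{-N}\beta\phi/\sigma,\ q^{-N}\delta_1\phi/\sigma,\ q^{-N}\delta_2\phi/\sigma)_L}\,q^L$$ $$\times\ {}_{10}W_9\left[q^{-L}f/e;\,\frac{tq}{ce},\frac{tq}{be},\frac{tq}{d_1e},\frac{tq}{d_2e},\frac{fq^{-L}}{t},fq^{-L},q^{-L};\,q;\,\frac{bcd_1d_2ef\,q^{-1}}{t^3}\right]$$ $$\times\ {}_{10}W_9\left[q^{L-N}\phi/\epsilon;\,\frac{\sigma q}{\gamma\epsilon},\frac{\sigma q}{\beta\epsilon},\frac{\sigma q}{\delta_1\epsilon},\frac{\sigma q}{\delta_2\epsilon},\frac{q^{L-N}\phi}{\sigma},q^L\phi,q^{L-N};\,q;\,\frac{\beta\gamma\delta_1\delta_2\epsilon\phi\,q^{-N-1}}{\sigma^3}\right].$$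
   Context: Fix a complex number $q$ with $0<|q|<1$. For $k\in\mathbb N=\{0,1,2,\dots\}$, $(a)_k=(a;q)_k=\prod_{i=0}^{k-1}(1-aq^i)$, and $(a_1,\dots,a_r)_k=(a_1)_k\cdots(a_r)_k$. The very well-poised basic hypergeometric series is $${}_{n+1}W_n[a_0;a_3,\dots,a_n;q;u]=\sum_{k\in\mathbb N}\frac{1-a_0q^{2k}}{1-a_0}\,\frac{(a_0)_k(a_3)_k\cdots(a_n)_k}{(q)_k(a_0q/a_3)_k\cdots(a_0q/a_n)_k}\,u^k .$$ All $W$-series in the claim terminate: when the last listed parameter is $q^{-M}$ with $M$ a nonnegative integer, the series is read as the finite sum over $0\le k\le M$. *)

theory Defs
  imports "HOL-Analysis.Analysis"
begin

definition qpoch :: "complex \<Rightarrow> complex \<Rightarrow> nat \<Rightarrow> complex" where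
  "qpoch q a k = (\<Prod>i<k. 1 - a * q ^ i)"

definition qpochs :: "complex \<Rightarrow> complex list \<Rightarrow> nat \<Rightarrow> complex" where
  "qpochs q as k = prod_list (map (\<lambda>a. qpoch q a k) as)"

definition vwp_term :: "complex \<Rightarrow> complex \<Rightarrow> complex list \<Rightarrow> complex \<Rightarrow> nat \<Rightarrow> complex" where
  "vwp_term q a0 as u k =
     (1 - a0 * q ^ (2 * k)) / (1 - a0) *
     (qpochs q (a0 # as) k / qpochs q (q # map (\<lambda>a. a0 * q / a) as) k) * u ^ k"

text \<open>
  The list \<open>as\<close> holds the parameters \<open>a\<^sub>3, \<dots>, a\<^sub>n\<close>; thus the series
  \<open>10W9\<close> has a list of length 7.  If the last parameter is \<open>q powi (- int M)\<close>, all terms with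
  index above \<open>M\<close> are zero and the series is the finite sum over \<open>k \<le> M\<close>;
  see \<open>vwp_series_terminating\<close>.
\<close>

definition vwp_series :: "complex \<Rightarrow> complex \<Rightarrow> complex list \<Rightarrow> complex \<Rightarrow> complex" where
  "vwp_series q a0 as u = (\<Sum>k. vwp_term q a0 as u k)"

definition vwp_nonvanishing :: "complex \<Rightarrow> complex \<Rightarrow> complex list \<Rightarrow> nat \<Rightarrow> bool" where
  "vwp_nonvanishing q a0 as M \<longleftrightarrow>
     1 - a0 \<noteq> 0 \<and> (\<forall>k\<le>M. qpochs q (q # map (\<lambda>a. a0 * q / a) as) k \<noteq> 0)"

lemma qpoch_terminating:
  assumes "q \<noteq> 0" "M < k"
  shows "qpoch q (q powi (- int M)) k = 0"
proof -
  have "1 - q powi (- int M) * q ^ M = 0"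
    using assms(1) by (simp add: power_int_minus)
  then show ?thesis
    unfolding qpoch_def using assms(2) by (intro prod_zero) auto
qed

lemma vwp_series_terminating:
  assumes "q \<noteq> 0"
  shows "vwp_series q a0 (as @ [q powi (- int M)]) u =
           (\<Sum>k\<le>M. vwp_term q a0 (as @ [q powi (- int M)]) u k)"
  unfolding vwp_series_def
proof (rule suminf_finite)
  fix k assume "k \<notin> {..M}"
  then have "qpoch q (q powi (- int M)) k = 0"
    using assms by (intro qpoch_terminating) auto
  then show "vwp_term q a0 (as @ [q powi (- int M)]) u k = 0"
    by (simp add: vwp_term_def qpochs_def)
qed simp

end

theory Submission
  imports Defs
begin

text \<open>
  The double series on each side is a convolution.  For variables \<open>x1\<close>, \<open>x2\<close>, four numerator parameters \<open>p\<^sub>j\<close>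
  and two denominator parameters \<open>y1\<close>, \<open>y2\<close>, let \<open>F\<^sub>K\<close> be the sum over \<open>k + l = K\<close> of the quotient of
  \<open>(x1 q\<^sup>k - x2 q\<^sup>l)/(x1 - x2) \<cdot> \<Prod>\<^sub>j (p\<^sub>j x1)\<^sub>k (p\<^sub>j x2)\<^sub>l\<close> by
  \<open>(q, q x1/x2, x1 y1, x1 y2)\<^sub>k (q, q x2/x1, x2 y1, x2 y2)\<^sub>l\<close>.
  Reversing the factors of length \<open>l = K - k\<close> turns \<open>F\<^sub>K\<close> into a product of shifted factorials times
  a terminating \<open>\<^sub>1\<^sub>0W\<^sub>9\<close> of base \<open>t q\<^sup>-\<^sup>K\<close>, where \<open>x1/x2 = t\<close> (lemma \<open>a1_cleared_eq_vwp\<close>).  The second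
  series in the theorem arises in the same way from a sequence \<open>G\<^sub>M\<close> with \<open>M = N - K\<close>.  With suitable
  constants the left side is therefore \<open>\<Sum> F\<^sub>K A\<^sup>N\<^sup>-\<^sup>K G\<^sub>N\<^sub>-\<^sub>K\<close> and the right side is
  \<open>\<Sum> A\<^sup>L F'\<^sub>L G'\<^sub>N\<^sub>-\<^sub>L\<close>, where a prime denotes the dual sum, in which the \<open>x\<close> and \<open>y\<close> are
  exchanged and every \<open>p\<^sub>j\<close> is inverted.

  In terms of generating functions, Kajihara's Euler transformation says
  \<open>F(u) = (A u)\<^sub>\<infinity> / (u)\<^sub>\<infinity> F'(A u)\<close> with \<open>A = p\<^sub>1 p\<^sub>2 p\<^sub>3 p\<^sub>4 x1 x2 / (y1 y2)\<close>.  The balancing condition of the theorem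
  says precisely that the multiplier belonging to \<open>G\<close> is \<open>1/A\<close>.  Hence the infinite products cancel in
  \<open>F(u) G(A u) = F'(A u) G'(u)\<close>, and the theorem is the coefficient of \<open>u\<^sup>N\<close> (lemmas
  \<open>qbinom_convolution\<close>, \<open>convolution_transform\<close>).

  The Euler transformation itself (\<open>a1_sum_euler\<close>) is proved by induction on the total index.  Splitting
  \<open>1 - q\<^sup>N\<^sup>+\<^sup>1\<close> by partial fractions in two different ways yields two recurrences:
  \<open>a1_sum_rec_shift\<close> expresses \<open>F\<^sub>N\<^sub>+\<^sub>1\<close> through \<open>F\<^sub>N\<close> with \<open>x1\<close> or \<open>x2\<close> multiplied by \<open>q\<close>, and
  \<open>a1_sum_rec_term\<close> expresses it through the terms of \<open>F\<^sub>N\<close> with rational weights.  Applying the first to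
  \<open>F\<close> and the second to \<open>F'\<close> reduces the claim to a termwise identity between residues of a single
  rational function (\<open>partial_fractions\<close>).
\<close>

section \<open>Shifted factorials\<close>

definition lin_prod :: "complex list \<Rightarrow> complex \<Rightarrow> complex" where
  "lin_prod ps z = (\<Prod>p\<leftarrow>ps. 1 - p * z)"

definition pochs_at :: "complex \<Rightarrow> complex list \<Rightarrow> complex \<Rightarrow> nat \<Rightarrow> complex" where
  "pochs_at q ps x k = qpochs q (map (\<lambda>p. p * x) ps) k"

lemma qpoch_0 [simp]: "qpoch q a 0 = 1"
  by (simp add: qpoch_def)

lemma qpoch_Suc: "qpoch q a (Suc k) = qpoch q a k * (1 - a * q ^ k)"
  by (simp add: qpoch_def)

lemma qpoch_Suc_shift: "qpoch q a (Suc k) = (1 - a) * qpoch q (a * q) k"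
  unfolding qpoch_def by (subst prod.lessThan_Suc_shift) (simp add: mult.assoc)

lemma qpoch_add: "qpoch q a (k + l) = qpoch q a k * qpoch q (a * q ^ k) l"
  by (induction l) (simp_all add: qpoch_Suc power_add mult_ac)

lemma qpoch_eq_0_iff: "qpoch q a k = 0 \<longleftrightarrow> (\<exists>i<k. a * q ^ i = 1)"
  unfolding qpoch_def by auto

lemma qpochs_Nil [simp]: "qpochs q [] k = 1"
  and qpochs_Cons [simp]: "qpochs q (a # as) k = qpoch q a k * qpochs q as k"
  by (simp_all add: qpochs_def)

lemma pochs_at_0 [simp]: "pochs_at q ps x 0 = 1"
  unfolding pochs_at_def by (induction ps) simp_all

lemma pochs_at_Suc: "pochs_at q ps x (Suc k) = pochs_at q ps x k * lin_prod ps (x * q ^ k)"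
  unfolding pochs_at_def lin_prod_def by (induction ps) (simp_all add: qpoch_Suc mult_ac)

lemma pochs_at_Suc_shift: "pochs_at q ps x (Suc k) = lin_prod ps x * pochs_at q ps (x * q) k"
  unfolding pochs_at_def lin_prod_def by (induction ps) (simp_all add: qpoch_Suc_shift mult_ac)

section \<open>Sums over pairs of indices with fixed total\<close>

text \<open>
  These are the \<open>A\<^sub>1\<close> terms of Milne's multiple series in two variables \<open>x1\<close>, \<open>x2\<close>, with a
  Vandermonde quotient in front.  With \<open>x1 = 1\<close>, \<open>x2 = 1/t\<close> and \<open>k + l = K\<close> the quotient becomes the
  very-well-poised factor of base \<open>t q\<^sup>-\<^sup>K\<close>; keeping both variables makes the symmetry in the two
  indices visible and allows each variable to be shifted by \<open>q\<close> separately.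
\<close>
definition a1_term :: "complex \<Rightarrow> complex list \<Rightarrow> complex list \<Rightarrow> complex \<Rightarrow> complex \<Rightarrow> nat \<Rightarrow> nat \<Rightarrow> complex" where
  "a1_term q ps ys x1 x2 k l =
     (x1 * q ^ k - x2 * q ^ l) / (x1 - x2) *
     (pochs_at q ps x1 k * pochs_at q ps x2 l) /
     (qpoch q q k * qpoch q q l * qpoch q (q * x1 / x2) k * qpoch q (q * x2 / x1) l *
      (pochs_at q ys x1 k * pochs_at q ys x2 l))"

definition a1_sum :: "complex \<Rightarrow> complex list \<Rightarrow> complex list \<Rightarrow> complex \<Rightarrow> complex \<Rightarrow> nat \<Rightarrow> complex" where
  "a1_sum q ps ys x1 x2 K = (\<Sum>k\<le>K. a1_term q ps ys x1 x2 k (K - k))"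

text \<open>
  The condition keeps the denominators that depend only on \<open>x1 / x2\<close>, and the Vandermonde differences, away
  from zero.  In this symmetric form it is inherited, with \<open>N\<close> lowered by one, when either variable is
  multiplied by \<open>q\<close>, as the induction over \<open>N\<close> requires.
\<close>
definition q_apart :: "complex \<Rightarrow> complex \<Rightarrow> complex \<Rightarrow> nat \<Rightarrow> bool" where
  "q_apart q x1 x2 N \<longleftrightarrow> x1 \<noteq> 0 \<and> x2 \<noteq> 0 \<and> (\<forall>i\<le>N. \<forall>j\<le>N. x1 * q ^ i \<noteq> x2 * q ^ j)"

lemma q_apartD: "q_apart q x1 x2 N \<Longrightarrow> i \<le> N \<Longrightarrow> j \<le> N \<Longrightarrow> x1 * q ^ i \<noteq> x2 * q ^ j"
  by (auto simp: q_apart_def)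

lemma q_apart_neq: "q_apart q x1 x2 N \<Longrightarrow> x1 \<noteq> x2"
  using q_apartD[of q x1 x2 N 0 0] by auto

lemma q_apart_nz: "q_apart q x1 x2 N \<Longrightarrow> x1 \<noteq> 0" "q_apart q x1 x2 N \<Longrightarrow> x2 \<noteq> 0"
  by (simp_all add: q_apart_def)

lemma q_apart_sym: "q_apart q x1 x2 N \<longleftrightarrow> q_apart q x2 x1 N"
  unfolding q_apart_def by metis

lemma q_apart_mono: "q_apart q x1 x2 N \<Longrightarrow> M \<le> N \<Longrightarrow> q_apart q x1 x2 M"
  unfolding q_apart_def by auto

lemma q_apart_shift: "q \<noteq> 0 \<Longrightarrow> q_apart q x1 x2 (Suc N) \<Longrightarrow> q_apart q (x1 * q) x2 N"
  unfolding q_apart_def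
  by (auto simp: mult.assoc simp flip: power_Suc)

lemma a1_term_sym: "a1_term q ps ys x1 x2 k l = a1_term q ps ys x2 x1 l k"
proof -
  have "(x1 * q ^ k - x2 * q ^ l) / (x1 - x2) = (x2 * q ^ l - x1 * q ^ k) / (x2 - x1)"
    by (metis minus_diff_eq minus_divide_divide)
  then show ?thesis
    unfolding a1_term_def by (simp add: mult_ac)
qed

lemma lin_prod_nz_of_pochs_at: "pochs_at q ys x (Suc N) \<noteq> 0 \<Longrightarrow> k \<le> N \<Longrightarrow> lin_prod ys (x * q ^ k) \<noteq> 0"
proof (induction N)
  case (Suc N)
  then show ?case
    by (cases "k = Suc N") (auto simp: pochs_at_Suc)
qed (simp add: pochs_at_Suc)

lemma pochs_at_mono: "pochs_at q ys x N \<noteq> 0 \<Longrightarrow> k \<le> N \<Longrightarrow> pochs_at q ys x k \<noteq> 0"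
  by (induction N) (auto simp: pochs_at_Suc le_Suc_eq)

lemma ratio_nz:
  assumes "q \<noteq> 0" "q_apart q x1 x2 N" "k \<le> N" "l \<le> N"
  shows "x1 * q ^ k / x2 \<noteq> q ^ l"
  using q_apartD[OF assms(2-4)] q_apart_nz[OF assms(2)] by (auto simp: field_simps)

lemma ratio_poch_nz:
  assumes "q \<noteq> 0" "q_apart q x1 x2 N" "k \<le> N"
  shows "qpoch q (q * x1 / x2) k \<noteq> 0"
  using ratio_nz[OF assms(1,2), of "Suc _" 0] assms(3)
  by (auto simp: qpoch_eq_0_iff mult_ac)

lemma qpoch_q_nz:
  assumes "\<forall>n>0. q ^ n \<noteq> 1"
  shows "qpoch q q k \<noteq> 0"
  using assms[rule_format, of "Suc _"] by (auto simp: qpoch_eq_0_iff)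

section \<open>Two recurrences in the total index\<close>

text \<open>
  The factor on the left is one of the two summands of \<open>1 - q\<^sup>N\<^sup>+\<^sup>1\<close> in the second splitting below;
  it vanishes at first index \<open>0\<close> and cancels the last denominator factors of the term with raised
  index, and the remaining weight is a residue in the variable \<open>X1\<close>.
\<close>
lemma a1_term_step_term:
  assumes "q \<noteq> 0" "\<forall>n>0. q ^ n \<noteq> 1" "q_apart q x1 x2 (Suc N)" "k + l \<le> N"
    and "pochs_at q ys x1 (Suc N) \<noteq> 0"
  defines "X1 \<equiv> x1 * q ^ k" and "X2 \<equiv> x2 * q ^ l"
  shows "(1 - q * X1 / x1) * (1 - q * X1 / x2) * X2 / (X2 - q * X1) * a1_term q ps ys x1 x2 (Suc k) l
       = a1_term q ps ys x1 x2 k l * (lin_prod ps X1 / lin_prod ys X1 * X2 / (X2 - X1))"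
proof -
  have alg: "c * b * X / a * (- a / x * (P * lp * P') / (Q * c * Q' * (R * b) * R' * (Y * ly * Y')))
     = - d / x * (P * P') / (Q * Q' * R * R' * (Y * Y')) * (lp / ly * X / d)"
    if "a \<noteq> 0" "b \<noteq> 0" "c \<noteq> 0" "d \<noteq> 0" for a b c d P P' lp ly Y Y' R R' X x Q Q' :: complex
  proof -
    define T where "T = - (X * P * lp * P' * inverse x * inverse Q * inverse Q' * inverse R * inverse R' * inverse Y * inverse Y' * inverse ly)"
    have "c * b * X / a * (- a / x * (P * lp * P') / (Q * c * Q' * (R * b) * R' * (Y * ly * Y')))
      = (a * inverse a) * (b * inverse b) * (c * inverse c) * T"
      unfolding T_def by (simp only: divide_inverse inverse_mult_distrib mult_ac mult_minus_left mult_minus_right)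
    moreover have "- d / x * (P * P') / (Q * Q' * R * R' * (Y * Y')) * (lp / ly * X / d) = (d * inverse d) * T"
      unfolding T_def by (simp only: divide_inverse inverse_mult_distrib mult_ac mult_minus_left mult_minus_right)
    ultimately show ?thesis using that by simp
  qed
  have x: "x1 \<noteq> 0" "x2 \<noteq> 0" "x1 \<noteq> x2" using q_apart_nz[OF assms(3)] q_apart_neq[OF assms(3)] by auto
  have nz: "X2 - q * X1 \<noteq> 0" "1 - q * X1 / x2 \<noteq> 0" "1 - q * q ^ k \<noteq> 0" "X2 - X1 \<noteq> 0"
    using q_apartD[OF assms(3), of "Suc k" l] q_apartD[OF assms(3), of k l] assms(2)[rule_format, of "Suc k"]
      ratio_nz[OF assms(1,3), of "Suc k" 0] assms(4)
    by (auto simp: X1_def X2_def mult_ac)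
  have e1: "1 - q * X1 / x1 = 1 - q * q ^ k"
    using x by (simp add: X1_def)
  have e2: "qpoch q (q * x1 / x2) (Suc k) = qpoch q (q * x1 / x2) k * (1 - q * X1 / x2)"
    by (simp add: qpoch_Suc X1_def)
  have e3: "x1 * q ^ Suc k - x2 * q ^ l = - (X2 - q * X1)" "x1 * q ^ k - x2 * q ^ l = - (X2 - X1)"
    by (simp_all add: X1_def X2_def)
  show ?thesis
    unfolding a1_term_def e1 e2 e3
    unfolding pochs_at_Suc qpoch_Suc[of q q] X1_def[symmetric]
    using nz by (rule alg)
qed

text \<open>
  The alternative factor, the summand of \<open>1 - q\<^sup>N\<^sup>+\<^sup>1\<close> in the first splitting, turns the
  term with raised index into the term whose variable \<open>x1\<close> is replaced by \<open>x1 q\<close>; what remains does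
  not depend on the indices.
\<close>
lemma a1_term_step_shift:
  assumes "q \<noteq> 0" "\<forall>n>0. q ^ n \<noteq> 1" "q_apart q x1 x2 (Suc N)" "k + l \<le> N"
  defines "X1 \<equiv> x1 * q ^ k" and "X2 \<equiv> x2 * q ^ l"
  shows "(1 - q * X1 / x1) * (1 - X2 / x1) * x1 / (x1 - x2) * a1_term q ps ys x1 x2 (Suc k) l
       = lin_prod ps x1 / lin_prod ys x1 * x2 / (x2 - x1) * a1_term q ps ys (x1 * q) x2 k l"
proof -
  have alg: "c * b * x1 / a * (z / a * (lp * P * P') / (Q * c * Q' * (d / x2 * R) * (R' * b * x1 / a) * (ly * Y * Y')))
     = lp / ly * x2 / - a * (z / - d * (P * P') / (Q * Q' * R * R' * (Y * Y')))"
    if "a \<noteq> 0" "b \<noteq> 0" "c \<noteq> 0" "d \<noteq> 0" "x1 \<noteq> 0" for a b c d P P' lp ly Y Y' R R' z x1 x2 Q Q' :: complex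
  proof -
    define T where "T = x2 * z * P * lp * P' * inverse Q * inverse Q' * inverse R * inverse R' * inverse Y * inverse Y' * inverse ly"
    have "c * b * x1 / a * (z / a * (lp * P * P') / (Q * c * Q' * (d / x2 * R) * (R' * b * x1 / a) * (ly * Y * Y')))
      = (a * inverse a) * (b * inverse b) * (c * inverse c) * (x1 * inverse x1) * (inverse a * inverse d * T)"
      unfolding T_def by (simp only: divide_inverse inverse_mult_distrib inverse_inverse_eq mult_ac)
    moreover have "lp / ly * x2 / - a * (z / - d * (P * P') / (Q * Q' * R * R' * (Y * Y'))) = inverse a * inverse d * T"
      unfolding T_def by (simp only: divide_inverse inverse_mult_distrib mult_ac mult_minus_left mult_minus_right inverse_minus_eq minus_minus)
    ultimately show ?thesis using that by simp
  qed
  have x: "x1 - x2 \<noteq> 0" "x2 - x1 * q \<noteq> 0" "x1 \<noteq> 0" "x2 \<noteq> 0"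
     using q_apart_nz[OF assms(3)] q_apart_neq[OF assms(3)] q_apartD[OF assms(3), of 1 0] by auto
  have nz: "1 - X2 / x1 \<noteq> 0" "1 - q * q ^ k \<noteq> 0"
    using ratio_nz[OF assms(1) assms(3)[unfolded q_apart_sym[of q x1]], of l 0] assms(4) assms(2)[rule_format, of "Suc k"]
    by (auto simp: X2_def)
  have e1: "1 - q * X1 / x1 = 1 - q * q ^ k"
    using x by (simp add: X1_def)
  have e2: "qpoch q (q * x1 / x2) (Suc k) = (x2 - x1 * q) / x2 * qpoch q (q * (x1 * q) / x2) k"
    using x unfolding qpoch_Suc_shift by (simp add: field_simps)
  have e4: "qpoch q (q * x2 / (x1 * q)) l * (1 - X2 / x1) = (x1 - x2) / x1 * qpoch q (q * x2 / x1) l"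
    using x \<open>q \<noteq> 0\<close> qpoch_Suc_shift[of q "x2 / x1" l] unfolding qpoch_Suc
    by (simp add: X2_def field_simps)
  have e4': "qpoch q (q * x2 / x1) l = qpoch q (q * x2 / (x1 * q)) l * (1 - X2 / x1) * x1 / (x1 - x2)"
    unfolding e4 using x by simp
  have e3: "x1 * q * q ^ k - x2 * q ^ l = x1 * q ^ Suc k - x2 * q ^ l" "x1 * q - x2 = - (x2 - x1 * q)" "x2 - x1 = - (x1 - x2)"
    by (simp_all)
  show ?thesis
    unfolding a1_term_def e1 e2 e3 e4' pochs_at_Suc_shift[of _ _ x1] qpoch_Suc[of q q]
    using x(1) nz x(2,3) by (rule alg)
qed

lemma sum_split_shift:
  fixes f g :: "nat \<Rightarrow> nat \<Rightarrow> complex"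
  assumes "f 0 (Suc N) = 0" "g (Suc N) 0 = 0"
  shows "(\<Sum>k\<le>Suc N. f k (Suc N - k) + g k (Suc N - k))
    = (\<Sum>k\<le>N. f (Suc k) (N - k) + g k (Suc (N - k)))"
proof -
  have "(\<Sum>k\<le>Suc N. f k (Suc N - k)) = (\<Sum>k\<le>N. f (Suc k) (N - k))"
    unfolding sum.atMost_Suc_shift[of _ N] using assms(1) by simp
  moreover have "(\<Sum>k\<le>Suc N. g k (Suc N - k)) = (\<Sum>k\<le>N. g k (Suc (N - k)))"
    unfolding sum.atMost_Suc[of _ N] using assms(2) by (simp add: Suc_diff_le)
  ultimately show ?thesis
    by (simp add: sum.distrib)
qed

text \<open>
  The identity
  \<open>1 - X1 X2/(x1 x2) = (1 - X1/x1)(1 - X2/x1) x1/(x1-x2) + (1 - X1/x2)(1 - X2/x2) x2/(x2-x1)\<close>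
  is applied with \<open>X1 = x1 q\<^sup>k\<close> and \<open>X2 = x2 q\<^sup>l\<close>.  Its two summands vanish at \<open>k = 0\<close> and at \<open>l = 0\<close>,
  so each of the two sums can be reindexed to total \<open>N\<close>.
\<close>
lemma a1_sum_rec_shift:
  assumes q: "q \<noteq> 0" "\<forall>n>0. q ^ n \<noteq> 1" and ap: "q_apart q x1 x2 (Suc N)"
  shows "(1 - q ^ Suc N) * a1_sum q ps ys x1 x2 (Suc N)
    = lin_prod ps x1 / lin_prod ys x1 * x2 / (x2 - x1) * a1_sum q ps ys (x1 * q) x2 N
      + lin_prod ps x2 / lin_prod ys x2 * x1 / (x1 - x2) * a1_sum q ps ys x1 (x2 * q) N"
proof -
  have x: "x1 \<noteq> 0" "x2 \<noteq> 0" "x1 - x2 \<noteq> 0"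
     using q_apart_nz[OF ap] q_apart_neq[OF ap] by auto
  define s where "s x x' X X' = (1 - X / x) * (1 - X' / x) * x / (x - x')" for x x' X X' :: complex
  define w where "w = a1_term q ps ys x1 x2"
  define f where "f k l = s x1 x2 (x1 * q ^ k) (x2 * q ^ l) * w k l" for k l
  define g where "g k l = s x2 x1 (x2 * q ^ l) (x1 * q ^ k) * w k l" for k l
  have s: "s x1 x2 X1 X2 + s x2 x1 X2 X1 = 1 - X1 * X2 / (x1 * x2)" for X1 X2
  proof -
    have "s x1 x2 X1 X2 + s x2 x1 X2 X1 = (s x1 x2 X1 X2 * (x1 * x2 * (x1 - x2)) + s x2 x1 X2 X1 * (x1 * x2 * (x1 - x2))) / (x1 * x2 * (x1 - x2))"
      using x by (simp add: add_divide_distrib)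
    also have "s x1 x2 X1 X2 * (x1 * x2 * (x1 - x2)) = (x1 - X1) * (x1 - X2) * x2"
      using x by (simp add: s_def field_simps)
    also have "s x2 x1 X2 X1 * (x1 * x2 * (x1 - x2)) = - (x2 - X1) * (x2 - X2) * x1"
    proof -
      have "s x2 x1 X2 X1 = - ((1 - X2 / x2) * (1 - X1 / x2) * x2 / (x1 - x2))"
        unfolding s_def by (metis minus_diff_eq minus_divide_right)
      moreover have "- (u * v * x2 / d) * (x1 * x2 * d) = - (v * x2) * (u * x2) * x1" if "d \<noteq> 0" for u v d
        using that by (simp add: mult_ac)
      ultimately have "s x2 x1 X2 X1 * (x1 * x2 * (x1 - x2)) = - ((1 - X1 / x2) * x2) * ((1 - X2 / x2) * x2) * x1"
        using x(3) by metis
      moreover have "(1 - X1 / x2) * x2 = x2 - X1" "(1 - X2 / x2) * x2 = x2 - X2"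
        using x by (simp_all add: left_diff_distrib)
      ultimately show ?thesis by (simp only:)
    qed
    also have "(x1 - X1) * (x1 - X2) * x2 + - (x2 - X1) * (x2 - X2) * x1 = (x1 * x2 - X1 * X2) * (x1 - x2)"
      by algebra
    also have "\<dots> / (x1 * x2 * (x1 - x2)) = 1 - X1 * X2 / (x1 * x2)"
      using x by (simp add: diff_divide_distrib)
    finally show ?thesis .
  qed
  have "(1 - q ^ Suc N) * a1_sum q ps ys x1 x2 (Suc N) = (\<Sum>k\<le>Suc N. (1 - q ^ Suc N) * w k (Suc N - k))"
    unfolding a1_sum_def w_def by (rule sum_distrib_left)
  also have "\<dots> = (\<Sum>k\<le>Suc N. f k (Suc N - k) + g k (Suc N - k))"
  proof (rule sum.cong)
    fix k assume k: "k \<in> {..Suc N}"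
    have "x1 * q ^ k * (x2 * q ^ (Suc N - k)) / (x1 * x2) = q ^ Suc N"
    proof -
      have "x1 * q ^ k * (x2 * q ^ (Suc N - k)) / (x1 * x2) = q ^ k * q ^ (Suc N - k)"
        using x by simp
      also have "\<dots> = q ^ Suc N"
        using k by (subst power_add[symmetric]) simp
      finally show ?thesis .
    qed
    then show "(1 - q ^ Suc N) * w k (Suc N - k) = f k (Suc N - k) + g k (Suc N - k)"
      unfolding f_def g_def distrib_right[symmetric] s by simp
  qed simp
  also have "\<dots> = (\<Sum>k\<le>N. f (Suc k) (N - k) + g k (Suc (N - k)))"
    by (rule sum_split_shift) (use x in \<open>simp_all add: f_def g_def s_def\<close>)
  also have "\<dots> = (\<Sum>k\<le>N. lin_prod ps x1 / lin_prod ys x1 * x2 / (x2 - x1) * a1_term q ps ys (x1 * q) x2 k (N - k)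
       + lin_prod ps x2 / lin_prod ys x2 * x1 / (x1 - x2) * a1_term q ps ys x1 (x2 * q) k (N - k))"
  proof (intro sum.cong refl arg_cong2[of _ _ _ _ "(+)"])
    fix k assume k: "k \<in> {..N}"
    show "f (Suc k) (N - k) = lin_prod ps x1 / lin_prod ys x1 * x2 / (x2 - x1) * a1_term q ps ys (x1 * q) x2 k (N - k)"
      using a1_term_step_shift[OF q ap, of k "N - k" ps ys] k by (simp add: f_def s_def w_def mult_ac)
    have "q_apart q x2 x1 (Suc N)" using ap by (simp add: q_apart_sym)
    from a1_term_step_shift[OF q this, of "N - k" k ps ys] k
    show "g k (Suc (N - k)) = lin_prod ps x2 / lin_prod ys x2 * x1 / (x1 - x2) * a1_term q ps ys x1 (x2 * q) k (N - k)"
      by (simp add: g_def s_def w_def mult_ac a1_term_sym[of q ps ys x1 "x2 * q"] a1_term_sym[of q ps ys x1 "x2"] a1_term_sym[of q ps ys x1 "q * x2"])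
  qed
  finally show ?thesis
    by (simp add: a1_sum_def sum.distrib sum_distrib_left)
qed

text \<open>
  A second splitting of \<open>1 - X1 X2/(x1 x2)\<close>, now by partial fractions in the nodes \<open>X1\<close>, \<open>X2\<close> instead of
  \<open>x1\<close>, \<open>x2\<close>.  Here the variables stay as they are and the coefficients depend on the indices, so that
  the sum can be compared term by term with others of total \<open>N\<close>.
\<close>
lemma a1_sum_rec_term:
  assumes q: "q \<noteq> 0" "\<forall>n>0. q ^ n \<noteq> 1" and ap: "q_apart q x1 x2 (Suc N)"
    and y: "pochs_at q ys x1 (Suc N) \<noteq> 0" "pochs_at q ys x2 (Suc N) \<noteq> 0"
  shows "(1 - q ^ Suc N) * a1_sum q ps ys x1 x2 (Suc N)
    = (\<Sum>k\<le>N. a1_term q ps ys x1 x2 k (N - k) *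
        (let X1 = x1 * q ^ k; X2 = x2 * q ^ (N - k) in
           lin_prod ps X1 / lin_prod ys X1 * X2 / (X2 - X1) + lin_prod ps X2 / lin_prod ys X2 * X1 / (X1 - X2)))"
proof -
  have x: "x1 \<noteq> 0" "x2 \<noteq> 0" "x1 - x2 \<noteq> 0"
     using q_apart_nz[OF ap] q_apart_neq[OF ap] by auto
  define s where "s X X' = (1 - X / x1) * (1 - X / x2) * X' / (X' - X)" for X X' :: complex
  define w where "w = a1_term q ps ys x1 x2"
  define f where "f k l = s (x1 * q ^ k) (x2 * q ^ l) * w k l" for k l
  define g where "g k l = s (x2 * q ^ l) (x1 * q ^ k) * w k l" for k l
  have s: "s X1 X2 + s X2 X1 = 1 - X1 * X2 / (x1 * x2)" if "X1 - X2 \<noteq> 0" for X1 X2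
  proof -
    have "s X1 X2 + s X2 X1 = (s X1 X2 * (x1 * x2 * (X1 - X2)) + s X2 X1 * (x1 * x2 * (X1 - X2))) / (x1 * x2 * (X1 - X2))"
      using x that by (simp add: add_divide_distrib)
    also have "s X2 X1 * (x1 * x2 * (X1 - X2)) = (x1 - X2) * (x2 - X2) * X1"
      using x that by (simp add: s_def field_simps)
    also have "s X1 X2 * (x1 * x2 * (X1 - X2)) = - (x1 - X1) * (x2 - X1) * X2"
    proof -
      have "s X1 X2 = - ((1 - X1 / x1) * (1 - X1 / x2) * X2 / (X1 - X2))"
        unfolding s_def by (metis minus_diff_eq minus_divide_right)
      then show ?thesis using x that by (simp add: field_simps)
    qed
    also have "- (x1 - X1) * (x2 - X1) * X2 + (x1 - X2) * (x2 - X2) * X1 = (x1 * x2 - X1 * X2) * (X1 - X2)"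
      by algebra
    also have "\<dots> / (x1 * x2 * (X1 - X2)) = 1 - X1 * X2 / (x1 * x2)"
      using x that by (simp add: diff_divide_distrib)
    finally show ?thesis .
  qed
  have "(1 - q ^ Suc N) * a1_sum q ps ys x1 x2 (Suc N) = (\<Sum>k\<le>Suc N. (1 - q ^ Suc N) * w k (Suc N - k))"
    unfolding a1_sum_def w_def by (rule sum_distrib_left)
  also have "\<dots> = (\<Sum>k\<le>Suc N. f k (Suc N - k) + g k (Suc N - k))"
  proof (rule sum.cong)
    fix k assume k: "k \<in> {..Suc N}"
    have "x1 * q ^ k * (x2 * q ^ (Suc N - k)) / (x1 * x2) = q ^ Suc N"
    proof -
      have "x1 * q ^ k * (x2 * q ^ (Suc N - k)) / (x1 * x2) = q ^ k * q ^ (Suc N - k)"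
        using x by simp
      also have "\<dots> = q ^ Suc N"
        using k by (subst power_add[symmetric]) simp
      finally show ?thesis .
    qed
    moreover have "x1 * q ^ k - x2 * q ^ (Suc N - k) \<noteq> 0"
      using q_apartD[OF ap, of k "Suc N - k"] k by simp
    note s[OF this]
    ultimately show "(1 - q ^ Suc N) * w k (Suc N - k) = f k (Suc N - k) + g k (Suc N - k)"
      unfolding f_def g_def distrib_right[symmetric] by (simp only:)
  qed simp
  also have "\<dots> = (\<Sum>k\<le>N. f (Suc k) (N - k) + g k (Suc (N - k)))"
    by (rule sum_split_shift) (use x in \<open>simp_all add: f_def g_def s_def\<close>)
  also have "\<dots> = (\<Sum>k\<le>N. a1_term q ps ys x1 x2 k (N - k) *
        (let X1 = x1 * q ^ k; X2 = x2 * q ^ (N - k) in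
           lin_prod ps X1 / lin_prod ys X1 * X2 / (X2 - X1) + lin_prod ps X2 / lin_prod ys X2 * X1 / (X1 - X2)))"
    unfolding Let_def distrib_left
  proof (intro sum.cong refl arg_cong2[of _ _ _ _ "(+)"])
    fix k assume k: "k \<in> {..N}"
    let ?X1 = "x1 * q ^ k" and ?X2 = "x2 * q ^ (N - k)"
    show "f (Suc k) (N - k) = a1_term q ps ys x1 x2 k (N - k) * (lin_prod ps ?X1 / lin_prod ys ?X1 * ?X2 / (?X2 - ?X1))"
      using a1_term_step_term[OF q ap, of k "N - k" ys ps] y k by (simp add: f_def s_def w_def mult_ac)
    have "q_apart q x2 x1 (Suc N)" using ap by (simp add: q_apart_sym)
    from a1_term_step_term[OF q this, of "N - k" k ys ps] y k
    show "g k (Suc (N - k)) = a1_term q ps ys x1 x2 k (N - k) * (lin_prod ps ?X2 / lin_prod ys ?X2 * ?X1 / (?X1 - ?X2))"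
      by (simp add: g_def s_def w_def mult_ac a1_term_sym[of q ps ys x1 "x2"])
  qed
  finally show ?thesis .
qed

text \<open>
  The residue theorem on the sphere for the differential with density
  \<open>\<Prod>(1 - p\<^sub>j z) / (z (1 - z/x1) (1 - z/x2) (1 - z Y1) (1 - z Y2))\<close>: the residues at \<open>1/Y1\<close>, \<open>1/Y2\<close> give the left side, those
  at \<open>x1\<close>, \<open>x2\<close> the bracket on the right.  The residue at \<open>0\<close> is \<open>1\<close>, and since four factors
  stand against four, there is only a simple pole at \<open>\<infinity>\<close>, with residue \<open>-A\<close>.
\<close>
lemma partial_fractions:
  fixes x1 :: complex
  assumes "x2 - x1 \<noteq> 0" "Y2 - Y1 \<noteq> 0" "Y1 \<noteq> 0" "Y2 \<noteq> 0"
    "p1 \<noteq> 0" "p2 \<noteq> 0" "p3 \<noteq> 0" "p4 \<noteq> 0"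
    and n: "1 - x1 * Y1 \<noteq> 0" "1 - x1 * Y2 \<noteq> 0" "1 - x2 * Y1 \<noteq> 0" "1 - x2 * Y2 \<noteq> 0"
  defines "A \<equiv> p1 * p2 * p3 * p4 * x1 * x2 / (Y1 * Y2)"
    and "ps \<equiv> [p1, p2, p3, p4]"
    and "ps' \<equiv> [1 / p1, 1 / p2, 1 / p3, 1 / p4]"
  shows "A * (lin_prod ps' Y1 / lin_prod [x1, x2] Y1 * Y2 / (Y2 - Y1) + lin_prod ps' Y2 / lin_prod [x1, x2] Y2 * Y1 / (Y1 - Y2))
   = A - 1 + (lin_prod ps x1 / lin_prod [Y1, Y2] x1 * x2 / (x2 - x1) + lin_prod ps x2 / lin_prod [Y1, Y2] x2 * x1 / (x1 - x2))"
proof -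
  \<comment> \<open>Elementary symmetric functions of the \<open>p\<^sub>j\<close> keep the polynomial identity \<open>key\<close> small.\<close>
  define e1 where "e1 = p1 + p2 + p3 + p4"
  define e2 where "e2 = p1*p2 + p1*p3 + p1*p4+p2*p3+p2*p4+p3*p4"
  define e3 where "e3 = p1*p2*p3+p1*p2*p4+p1*p3*p4+p2*p3*p4"
  define e4 where "e4 = p1*p2*p3*p4"
  define P where "P z = 1 - e1 * z + e2 * z^2 - e3 * z^3 + e4 * z^4" for z
  define R where "R z = e4 - e3 * z + e2 * z^2 - e1 * z^3 + z^4" for z
  have P: "lin_prod ps z = P z" for z
    unfolding ps_def lin_prod_def P_def e1_def e2_def e3_def e4_def list.map prod_list.Cons prod_list.Nil by algebra
  have Q: "e4 * lin_prod ps' z = R z" for z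
  proof -
    have "e4 * lin_prod ps' z = (p1 * (1 - z/p1)) * (p2 * (1 - z/p2)) * (p3 * (1 - z/p3)) * (p4 * (1 - z / p4))"
      unfolding e4_def ps'_def lin_prod_def by (simp add: mult_ac)
    also have "\<dots> = (p1 - z) * (p2 - z) * (p3 - z) * (p4 - z)"
      using assms by (simp add: right_diff_distrib)
    also have "\<dots> = R z"
      unfolding R_def e1_def e2_def e3_def e4_def by algebra
    finally show ?thesis .
  qed
  define a b c d where "a = 1 - x1 * Y1" and "b = 1 - x2 * Y1" and "c = 1 - x1 * Y2" and "d = 1 - x2 * Y2"
  have nz: "a \<noteq> 0" "b \<noteq> 0" "c \<noteq> 0" "d \<noteq> 0" using n by (simp_all add: a_def b_def c_def d_def)
  have key: "(x1 * x2 * (R Y1 * Y2 * c * d - R Y2 * Y1 * a * b)) * (x2 - x1)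
    = ((e4 * x1 * x2 - Y1 * Y2) * a * b * c * d * (x2 - x1) + Y1 * Y2 * (P x1 * x2 * b * d - P x2 * x1 * a * c)) * (Y2 - Y1)"
    unfolding R_def P_def a_def b_def c_def d_def by algebra
  have neg: "z / (Y1 - Y2) = - (z / (Y2 - Y1))" "z / (x1 - x2) = - (z / (x2 - x1))" for z
    by (metis minus_diff_eq minus_divide_right)+
  have "A * (lin_prod ps' Y1 / lin_prod [x1, x2] Y1 * Y2 / (Y2 - Y1) + lin_prod ps' Y2 / lin_prod [x1, x2] Y2 * Y1 / (Y1 - Y2))
     = x1 * x2 / (Y1 * Y2) * ((e4 * lin_prod ps' Y1) / (a * b) * Y2 / (Y2 - Y1) - (e4 * lin_prod ps' Y2) / (c * d) * Y1 / (Y2 - Y1))"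
    unfolding neg A_def e4_def[symmetric]
    by (simp add: lin_prod_def a_def b_def c_def d_def right_diff_distrib mult_ac)
  also have "\<dots> = (x1 * x2 * (R Y1 * Y2 * c * d - R Y2 * Y1 * a * b)) / (Y1 * Y2 * a * b * c * d * (Y2 - Y1))"
  proof -
    have "x1 * x2 / (Y1 * Y2) * (r / (a * b) * Y2 / D - r' / (c * d) * Y1 / D)
      = (x1 * x2 * (r * Y2 * c * d - r' * Y1 * a * b)) / (Y1 * Y2 * a * b * c * d * D)" if "D \<noteq> 0" for r r' D
      using nz assms(3,4) that by (simp add: field_simps)
    then show ?thesis unfolding Q using assms(2) by blast
  qed
  also have "\<dots> = ((e4 * x1 * x2 - Y1 * Y2) * a * b * c * d * (x2 - x1) + Y1 * Y2 * (P x1 * x2 * b * d - P x2 * x1 * a * c)) / (Y1 * Y2 * a * b * c * d * (x2 - x1))"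
    (is "?n1 / (?D * _) = ?n2 / _")
  proof -
    have "?D \<noteq> 0" using nz assms by simp
    moreover have "n1 / (D * u) = n2 / (D * v)" if "n1 * v = n2 * u" "D \<noteq> 0" "u \<noteq> 0" "v \<noteq> 0"
      for n1 n2 D u v :: complex
      using that by (simp add: field_simps)
    ultimately show ?thesis using key assms(1,2) by blast
  qed
  also have "\<dots> = (e4 * x1 * x2 - Y1 * Y2) / (Y1 * Y2) + (P x1 / (a * c) * x2 / (x2 - x1) - P x2 / (b * d) * x1 / (x2 - x1))"
  proof -
    have "((e4 * x1 * x2 - Y1 * Y2) * a * b * c * d * D + Y1 * Y2 * (r * x2 * b * d - r' * x1 * a * c)) / (Y1 * Y2 * a * b * c * d * D)
      = (e4 * x1 * x2 - Y1 * Y2) / (Y1 * Y2) + (r / (a * c) * x2 / D - r' / (b * d) * x1 / D)" if "D \<noteq> 0" for r r' D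
      using nz assms(3,4) that by (simp add: field_simps)
    then show ?thesis using assms(1) by blast
  qed
  also have "(e4 * x1 * x2 - Y1 * Y2) / (Y1 * Y2) = A - 1"
    using assms(3,4) by (simp add: A_def e4_def diff_divide_distrib)
  finally show ?thesis
    unfolding neg P by (simp add: lin_prod_def a_def b_def c_def d_def mult_ac)
qed

section \<open>The Euler transformation\<close>

text \<open>
  The coefficient of \<open>u\<^sup>n\<close> in \<open>(A u; q)\<^sub>\<infinity> / (u; q)\<^sub>\<infinity>\<close>, by the \<open>q\<close>-binomial theorem.
\<close>
definition qbinom :: "complex \<Rightarrow> complex \<Rightarrow> nat \<Rightarrow> complex" where
  "qbinom q A n = qpoch q A n / qpoch q q n"

lemma pochs_at_swap:
  "pochs_at q [x1, x2] y1 k * pochs_at q [x1, x2] y2 k = pochs_at q [y1, y2] x1 k * pochs_at q [y1, y2] x2 k"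
  by (simp add: pochs_at_def mult_ac)

lemma lin_prod_pair_nz:
  assumes "pochs_at q [x1, x2] y1 (Suc N) \<noteq> 0" "k \<le> N"
  shows "1 - x1 * (y1 * q ^ k) \<noteq> 0" "1 - x2 * (y1 * q ^ k) \<noteq> 0"
  using lin_prod_nz_of_pochs_at[OF assms] by (simp_all add: lin_prod_def)

lemma a1_sum_0: "x1 \<noteq> x2 \<Longrightarrow> a1_sum q ps ys x1 x2 0 = 1"
  by (simp add: a1_sum_def a1_term_def)

lemma qpoch_shift_ratio: "qpoch q (a * q) k * (1 - a) = qpoch q a k * (1 - a * q ^ k)"
  using qpoch_Suc[of q a k] qpoch_Suc_shift[of q a k] by (simp add: mult_ac)

lemma a1_term_ys_shift:
  assumes "1 - x1 * y1 \<noteq> 0" "1 - x1 * y2 \<noteq> 0" "1 - x1 * (y1 * q ^ k) \<noteq> 0" "1 - x1 * (y2 * q ^ l) \<noteq> 0"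
  shows "a1_term q ps [x1 * q, x2] y1 y2 k l
    = a1_term q ps [x1, x2] y1 y2 k l * lin_prod [y1, y2] x1 / lin_prod [y1 * q ^ k, y2 * q ^ l] x1"
proof -
  have e: "pochs_at q [x1 * q, x2] y k = pochs_at q [x1, x2] y k * ((1 - x1 * (y * q ^ k)) / (1 - x1 * y))"
    if "1 - x1 * y \<noteq> 0" for y k
  proof -
    have "qpoch q (x1 * q * y) k = qpoch q (x1 * y) k * ((1 - x1 * (y * q ^ k)) / (1 - x1 * y))"
      using qpoch_shift_ratio[of q "x1 * y" k] that by (simp add: field_simps)
    then show ?thesis by (simp add: pochs_at_def mult_ac)
  qed
  have alg: "z / (a * (P * (u / v) * (P' * (u' / v')))) = z / (a * (P * P')) * (v * v') / (u * u')"
    for z a P u v P' u' v' :: complex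
    by (simp add: divide_inverse mult_ac)
  have l: "lin_prod [a, b] x1 = (1 - x1 * a) * (1 - x1 * b)" for a b
    by (simp add: lin_prod_def mult.commute)
  show ?thesis
    unfolding a1_term_def e[OF assms(1)] e[OF assms(2)] l by (rule alg)
qed

text \<open>
  The bridge between the two sides of the Euler transformation: the combination of \<open>q\<close>-shifts in
  \<open>x1\<close>, \<open>x2\<close> that occurs in \<open>a1_sum_rec_shift\<close>, applied to the dual sum, where \<open>x1\<close>, \<open>x2\<close> sit in the
  denominators.  Such a shift multiplies a dual term by a rational function of \<open>Y1 = y1 q\<^sup>k\<close>,
  \<open>Y2 = y2 q\<^sup>l\<close>, and \<open>partial_fractions\<close> trades it for the coefficients of \<open>a1_sum_rec_term\<close>.
\<close>
lemma dual_step: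
  assumes q: "q \<noteq> 0" "\<forall>n>0. q ^ n \<noteq> 1"
    and x: "x1 \<noteq> x2" and y: "q_apart q y1 y2 (Suc K)"
    and xy: "pochs_at q [x1, x2] y1 (Suc K) \<noteq> 0" "pochs_at q [x1, x2] y2 (Suc K) \<noteq> 0"
    and p: "p1 \<noteq> 0" "p2 \<noteq> 0" "p3 \<noteq> 0" "p4 \<noteq> 0"
  defines "A \<equiv> p1 * p2 * p3 * p4 * x1 * x2 / (y1 * y2)"
    and "ps \<equiv> [p1, p2, p3, p4]"
    and "ps' \<equiv> [1 / p1, 1 / p2, 1 / p3, 1 / p4]"
  shows "q ^ K * (lin_prod ps x1 / lin_prod [y1, y2] x1 * x2 / (x2 - x1) * a1_sum q ps' [x1 * q, x2] y1 y2 K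
      + lin_prod ps x2 / lin_prod [y1, y2] x2 * x1 / (x1 - x2) * a1_sum q ps' [x1, x2 * q] y1 y2 K)
    = A * ((1 - q ^ Suc K) * a1_sum q ps' [x1, x2] y1 y2 (Suc K)) + (q ^ K - A) * a1_sum q ps' [x1, x2] y1 y2 K"
proof -
  define w where "w = a1_term q ps' [x1, x2] y1 y2"
  have FFw: "a1_sum q ps' [x1, x2] y1 y2 K = (\<Sum>k\<le>K. w k (K - k))"
    by (simp add: a1_sum_def w_def)
  have "q ^ K * (lin_prod ps x1 / lin_prod [y1, y2] x1 * x2 / (x2 - x1) * a1_term q ps' [x1 * q, x2] y1 y2 k (K - k)
      + lin_prod ps x2 / lin_prod [y1, y2] x2 * x1 / (x1 - x2) * a1_term q ps' [x1, x2 * q] y1 y2 k (K - k))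
    = A * (w k (K - k) * (let Y1 = y1 * q ^ k; Y2 = y2 * q ^ (K - k) in
           lin_prod ps' Y1 / lin_prod [x1, x2] Y1 * Y2 / (Y2 - Y1) + lin_prod ps' Y2 / lin_prod [x1, x2] Y2 * Y1 / (Y1 - Y2)))
      + (q ^ K - A) * w k (K - k)" if k: "k \<le> K" for k
  proof -
    define l where "l = K - k"
    define Y1 Y2 where "Y1 = y1 * q ^ k" and "Y2 = y2 * q ^ l"
    have ynz: "y1 \<noteq> 0" "y2 \<noteq> 0" using q_apart_nz[OF y] by auto
    have Ynz: "Y1 \<noteq> 0" "Y2 \<noteq> 0" using ynz q by (auto simp: Y1_def Y2_def)
    have Yne: "Y2 - Y1 \<noteq> 0"
    proof -
      have "k \<le> Suc K" "l \<le> Suc K" using k by (auto simp: l_def)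
      from q_apartD[OF y this] show ?thesis by (auto simp: Y1_def Y2_def)
    qed
    have n0: "1 - x1 * y1 \<noteq> 0" "1 - x1 * y2 \<noteq> 0" "1 - x2 * y1 \<noteq> 0" "1 - x2 * y2 \<noteq> 0"
      using lin_prod_pair_nz[OF xy(1), of 0] lin_prod_pair_nz[OF xy(2), of 0] by simp_all
    have n: "1 - x1 * Y1 \<noteq> 0" "1 - x1 * Y2 \<noteq> 0" "1 - x2 * Y1 \<noteq> 0" "1 - x2 * Y2 \<noteq> 0"
      using lin_prod_pair_nz[OF xy(1), of k] lin_prod_pair_nz[OF xy(2), of l] k by (simp_all add: Y1_def Y2_def l_def)
    have w1: "a1_term q ps' [x1 * q, x2] y1 y2 k l = w k l * lin_prod [y1, y2] x1 / lin_prod [Y1, Y2] x1"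
      using a1_term_ys_shift[of x1 y1 y2 q k l ps' x2] n0 n by (simp add: w_def Y1_def Y2_def)
    have "a1_term q ps' [x1, x2 * q] y1 y2 k l = a1_term q ps' [x2 * q, x1] y1 y2 k l"
      by (simp add: a1_term_def pochs_at_def mult_ac)
    also have "\<dots> = a1_term q ps' [x2, x1] y1 y2 k l * lin_prod [y1, y2] x2 / lin_prod [Y1, Y2] x2"
      using a1_term_ys_shift[of x2 y1 y2 q k l ps' x1] n0 n by (simp add: Y1_def Y2_def)
    also have "a1_term q ps' [x2, x1] y1 y2 k l = w k l"
      by (simp add: w_def a1_term_def pochs_at_def mult_ac)
    finally have w2: "a1_term q ps' [x1, x2 * q] y1 y2 k l = w k l * lin_prod [y1, y2] x2 / lin_prod [Y1, Y2] x2" .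
    have lnz: "lin_prod [y1, y2] x1 \<noteq> 0" "lin_prod [y1, y2] x2 \<noteq> 0"
      using n0 by (simp_all add: lin_prod_def mult.commute)
    have "q ^ k * q ^ l = q ^ K" using k by (simp add: l_def flip: power_add)
    then have A: "A = q ^ K * (p1 * p2 * p3 * p4 * x1 * x2 / (Y1 * Y2))"
      using q ynz by (simp add: A_def Y1_def Y2_def field_simps)
    let ?S = "lin_prod ps' Y1 / lin_prod [x1, x2] Y1 * Y2 / (Y2 - Y1) + lin_prod ps' Y2 / lin_prod [x1, x2] Y2 * Y1 / (Y1 - Y2)"
    let ?T = "lin_prod ps x1 / lin_prod [Y1, Y2] x1 * x2 / (x2 - x1) + lin_prod ps x2 / lin_prod [Y1, Y2] x2 * x1 / (x1 - x2)"
    have pf: "A * ?S = A - q ^ K + q ^ K * ?T"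
    proof -
      have x': "x2 - x1 \<noteq> 0" using x by simp
      show ?thesis
        using arg_cong[OF partial_fractions[OF x' Yne Ynz p n], of "\<lambda>z. q ^ K * z"]
        unfolding A ps_def ps'_def by (simp only: distrib_left right_diff_distrib mult.assoc mult_1_right)
    qed
    have "lin_prod ps x1 / lin_prod [y1, y2] x1 * x2 / (x2 - x1) * a1_term q ps' [x1 * q, x2] y1 y2 k l
        = w k l * (lin_prod ps x1 / lin_prod [Y1, Y2] x1 * x2 / (x2 - x1))"
      unfolding w1 using lnz by (simp add: mult_ac)
    moreover have "lin_prod ps x2 / lin_prod [y1, y2] x2 * x1 / (x1 - x2) * a1_term q ps' [x1, x2 * q] y1 y2 k l
        = w k l * (lin_prod ps x2 / lin_prod [Y1, Y2] x2 * x1 / (x1 - x2))"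
      unfolding w2 using lnz by (simp add: mult_ac)
    ultimately have "q ^ K * (lin_prod ps x1 / lin_prod [y1, y2] x1 * x2 / (x2 - x1) * a1_term q ps' [x1 * q, x2] y1 y2 k l
      + lin_prod ps x2 / lin_prod [y1, y2] x2 * x1 / (x1 - x2) * a1_term q ps' [x1, x2 * q] y1 y2 k l) = w k l * (q ^ K * ?T)"
      by (simp only: distrib_left mult_ac)
    also have "\<dots> = w k l * (A * ?S) + (q ^ K - A) * w k l"
      unfolding pf by (simp only: algebra_simps)
    finally show ?thesis
      unfolding l_def[symmetric] Y1_def[symmetric] Y2_def[symmetric] Let_def by (simp only: mult.left_commute[of A])
  qed
  then have "(\<Sum>k\<le>K. q ^ K * (lin_prod ps x1 / lin_prod [y1, y2] x1 * x2 / (x2 - x1) * a1_term q ps' [x1 * q, x2] y1 y2 k (K - k)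
      + lin_prod ps x2 / lin_prod [y1, y2] x2 * x1 / (x1 - x2) * a1_term q ps' [x1, x2 * q] y1 y2 k (K - k)))
    = (\<Sum>k\<le>K. A * (w k (K - k) * (let Y1 = y1 * q ^ k; Y2 = y2 * q ^ (K - k) in
           lin_prod ps' Y1 / lin_prod [x1, x2] Y1 * Y2 / (Y2 - Y1) + lin_prod ps' Y2 / lin_prod [x1, x2] Y2 * Y1 / (Y1 - Y2)))
      + (q ^ K - A) * w k (K - k))"
    by (intro sum.cong) auto
  then show ?thesis
    unfolding a1_sum_rec_term[OF q y xy] FFw
    unfolding a1_sum_def w_def sum.distrib sum_distrib_left[symmetric] .
qed

text \<open>
  Comparison of the coefficients of one dual sum in the induction step for \<open>a1_sum_euler\<close>: the left
  side collects its contributions from the two terms of \<open>dual_step\<close>.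
\<close>
lemma qbinom_step:
  assumes q: "\<forall>n>0. q ^ n \<noteq> 1"
  shows "qbinom q (q * A) (Suc n) * (1 - q ^ K) + qbinom q (q * A) n * (q ^ K - A) = (1 - q ^ (Suc n + K)) * qbinom q A (Suc n)"
proof -
  define P where "P = qpoch q (q * A) n"
  define Q where "Q = qpoch q q n"
  have nz: "Q \<noteq> 0" "1 - q * q ^ n \<noteq> 0"
    using qpoch_q_nz[OF q, of n] q[rule_format, of "Suc n"] by (auto simp: Q_def)
  have a: "qbinom q A (Suc n) = (1 - A) * P / (Q * (1 - q * q ^ n))"
    unfolding qbinom_def qpoch_Suc[of q q] by (simp add: qpoch_Suc_shift P_def Q_def mult.commute)
  have b: "qbinom q (q * A) (Suc n) = P * (1 - q * A * q ^ n) / (Q * (1 - q * q ^ n))"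
    unfolding qbinom_def qpoch_Suc by (simp add: P_def Q_def)
  have c: "qbinom q (q * A) n = P * (1 - q * q ^ n) / (Q * (1 - q * q ^ n))"
    using nz by (simp add: qbinom_def P_def Q_def)
  have "P * (1 - q * A * q ^ n) * (1 - q ^ K) + P * (1 - q * q ^ n) * (q ^ K - A) = (1 - q ^ (Suc n + K)) * ((1 - A) * P)"
    unfolding power_add power_Suc by algebra
  then show ?thesis
    unfolding a b c times_divide_eq_left add_divide_distrib[symmetric] times_divide_eq_right by simp
qed

text \<open>
  Kajihara's Euler transformation for a pair of two-dimensional series, read off as coefficients of
  \<open>u\<^sup>N\<close> in \<open>F(u) = (A u)\<^sub>\<infinity> / (u)\<^sub>\<infinity> F'(A u)\<close>.  Both sides obey the recurrence \<open>a1_sum_rec_shift\<close>, which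
  determines the value at \<open>N + 1\<close> from the values at \<open>N\<close> with \<open>x1\<close> or \<open>x2\<close> multiplied by \<open>q\<close>; this is
  why \<open>x1\<close>, \<open>x2\<close> are generalized in the induction while \<open>y1\<close>, \<open>y2\<close> are fixed.
\<close>
theorem a1_sum_euler:
  assumes q: "q \<noteq> 0" "\<forall>n>0. q ^ n \<noteq> 1"
    and x: "q_apart q x1 x2 N" and y: "q_apart q y1 y2 N"
    and xy: "pochs_at q [y1, y2] x1 N \<noteq> 0" "pochs_at q [y1, y2] x2 N \<noteq> 0"
    and p: "p1 \<noteq> 0" "p2 \<noteq> 0" "p3 \<noteq> 0" "p4 \<noteq> 0"
  shows "a1_sum q [p1, p2, p3, p4] [y1, y2] x1 x2 N
     = (\<Sum>K\<le>N. qbinom q (p1 * p2 * p3 * p4 * x1 * x2 / (y1 * y2)) (N - K) *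
          (p1 * p2 * p3 * p4 * x1 * x2 / (y1 * y2)) ^ K * a1_sum q [1 / p1, 1 / p2, 1 / p3, 1 / p4] [x1, x2] y1 y2 K)"
  using x y xy
proof (induction N arbitrary: x1 x2)
  case 0
  then show ?case
    using q_apart_neq[OF 0(1)] q_apart_neq[OF 0(2)] by (simp add: a1_sum_0 qbinom_def)
next
  case (Suc N)
  define A where "A = p1 * p2 * p3 * p4 * x1 * x2 / (y1 * y2)"
  define c1 where "c1 = lin_prod [p1, p2, p3, p4] x1 / lin_prod [y1, y2] x1 * x2 / (x2 - x1)"
  define c2 where "c2 = lin_prod [p1, p2, p3, p4] x2 / lin_prod [y1, y2] x2 * x1 / (x1 - x2)"
  define F where "F = a1_sum q [1 / p1, 1 / p2, 1 / p3, 1 / p4] [x1, x2] y1 y2"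
  define F1 where "F1 = a1_sum q [1 / p1, 1 / p2, 1 / p3, 1 / p4] [x1 * q, x2] y1 y2"
  define F2 where "F2 = a1_sum q [1 / p1, 1 / p2, 1 / p3, 1 / p4] [x1, x2 * q] y1 y2"
  have yN: "q_apart q y1 y2 N" using q_apart_mono[OF Suc.prems(2)] by simp
  have x1: "q_apart q (x1 * q) x2 N" by (rule q_apart_shift[OF q(1) Suc.prems(1)])
  have x2: "q_apart q x1 (x2 * q) N"
    using q_apart_shift[OF q(1), of x2 x1 N] Suc.prems(1) by (simp add: q_apart_sym[of q x1])
  have xyq: "pochs_at q [y1, y2] (x1 * q) N \<noteq> 0" "pochs_at q [y1, y2] (x2 * q) N \<noteq> 0"
    using Suc.prems(3,4) by (simp_all add: pochs_at_Suc_shift)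
  have xyN: "pochs_at q [y1, y2] x1 N \<noteq> 0" "pochs_at q [y1, y2] x2 N \<noteq> 0"
    using Suc.prems(3,4) by (simp_all add: pochs_at_Suc)
  have qA: "p1 * p2 * p3 * p4 * (x1 * q) * x2 / (y1 * y2) = q * A"
    "p1 * p2 * p3 * p4 * x1 * (x2 * q) / (y1 * y2) = q * A"
    by (simp_all add: A_def)
  note IH = Suc.IH[OF x1 yN xyq(1) xyN(2), unfolded qA, folded F1_def]
    Suc.IH[OF x2 yN xyN(1) xyq(2), unfolded qA, folded F2_def]
  have step: "q ^ K * (c1 * F1 K + c2 * F2 K) = A * ((1 - q ^ Suc K) * F (Suc K)) + (q ^ K - A) * F K"
    if K: "K \<le> N" for K
    unfolding c1_def c2_def F1_def F2_def A_def F_def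
  proof (rule dual_step[OF q q_apart_neq[OF Suc.prems(1)] _ _ _ p])
    show "q_apart q y1 y2 (Suc K)" using q_apart_mono[OF Suc.prems(2)] K by simp
    have "pochs_at q [y1, y2] x1 (Suc K) \<noteq> 0" "pochs_at q [y1, y2] x2 (Suc K) \<noteq> 0"
      using pochs_at_mono[OF Suc.prems(3)] pochs_at_mono[OF Suc.prems(4)] K by simp_all
    then show "pochs_at q [x1, x2] y1 (Suc K) \<noteq> 0" "pochs_at q [x1, x2] y2 (Suc K) \<noteq> 0"
      using pochs_at_swap[of q x1 x2 y1 "Suc K" y2] by auto
  qed
  have "(1 - q ^ Suc N) * a1_sum q [p1, p2, p3, p4] [y1, y2] x1 x2 (Suc N)
    = c1 * (\<Sum>K\<le>N. qbinom q (q * A) (N - K) * (q * A) ^ K * F1 K)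
      + c2 * (\<Sum>K\<le>N. qbinom q (q * A) (N - K) * (q * A) ^ K * F2 K)"
    using a1_sum_rec_shift[OF q Suc.prems(1), of "[p1, p2, p3, p4]" "[y1, y2]"]
    unfolding c1_def c2_def IH .
  also have "\<dots> = (\<Sum>K\<le>N. qbinom q (q * A) (N - K) * A ^ K * (q ^ K * (c1 * F1 K + c2 * F2 K)))"
    unfolding sum_distrib_left sum.distrib[symmetric]
    by (intro sum.cong refl) (simp add: algebra_simps)
  also have "\<dots> = (\<Sum>K\<le>N. qbinom q (q * A) (N - K) * A ^ K * (A * ((1 - q ^ Suc K) * F (Suc K)) + (q ^ K - A) * F K))"
    by (intro sum.cong refl arg_cong2[of _ _ _ _ "(*)"] step) simp
  also have "\<dots> = (\<Sum>K\<le>N. qbinom q (q * A) (Suc N - Suc K) * A ^ Suc K * ((1 - q ^ Suc K) * F (Suc K)))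
       + (\<Sum>K\<le>N. qbinom q (q * A) (N - K) * A ^ K * (q ^ K - A) * F K)"
    unfolding sum.distrib[symmetric] by (intro sum.cong refl) (simp add: algebra_simps)
  also have "(\<Sum>K\<le>N. qbinom q (q * A) (Suc N - Suc K) * A ^ Suc K * ((1 - q ^ Suc K) * F (Suc K)))
     = (\<Sum>K\<le>Suc N. qbinom q (q * A) (Suc N - K) * A ^ K * ((1 - q ^ K) * F K))"
    unfolding sum.atMost_Suc_shift[of _ N] by simp
  also have "\<dots> = (\<Sum>K\<le>N. qbinom q (q * A) (Suc N - K) * A ^ K * ((1 - q ^ K) * F K)) + A ^ Suc N * ((1 - q ^ Suc N) * F (Suc N))"
    by (simp add: qbinom_def)
  also have "\<dots> + (\<Sum>K\<le>N. qbinom q (q * A) (N - K) * A ^ K * (q ^ K - A) * F K)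
    = (\<Sum>K\<le>N. A ^ K * F K * (qbinom q (q * A) (Suc (N - K)) * (1 - q ^ K) + qbinom q (q * A) (N - K) * (q ^ K - A)))
       + A ^ Suc N * ((1 - q ^ Suc N) * F (Suc N))"
    unfolding distrib_left sum.distrib by (simp add: Suc_diff_le mult_ac)
  also have "\<dots> = (\<Sum>K\<le>N. (1 - q ^ Suc N) * (qbinom q A (Suc N - K) * A ^ K * F K)) + A ^ Suc N * ((1 - q ^ Suc N) * F (Suc N))"
  proof (intro arg_cong2[of _ _ _ _ "(+)"] sum.cong refl)
    fix K assume K: "K \<in> {..N}"
    then have "Suc (N - K) + K = Suc N" "Suc N - K = Suc (N - K)" by auto
    then show "A ^ K * F K * (qbinom q (q * A) (Suc (N - K)) * (1 - q ^ K) + qbinom q (q * A) (N - K) * (q ^ K - A))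
      = (1 - q ^ Suc N) * (qbinom q A (Suc N - K) * A ^ K * F K)"
      using qbinom_step[OF q(2), of A "N - K" K] by (simp only: mult_ac)
  qed
  also have "\<dots> = (1 - q ^ Suc N) * (\<Sum>K\<le>Suc N. qbinom q A (Suc N - K) * A ^ K * F K)"
    by (simp add: sum_distrib_left distrib_left qbinom_def)
  finally show ?case
    using q(2)[rule_format, of "Suc N"] by (simp add: A_def F_def)
qed

section \<open>Convolution of two Euler transformations\<close>

lemma qbinom_Suc:
  assumes "\<forall>n>0. q ^ n \<noteq> 1"
  shows "(1 - q ^ Suc n) * qbinom q A (Suc n) = (1 - A * q ^ n) * qbinom q A n"
  using qpoch_q_nz[OF assms, of n] assms[rule_format, of "Suc n"]
  by (simp add: qbinom_def qpoch_Suc mult_ac)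

text \<open>
  This is \<open>(A u)\<^sub>\<infinity> / (u)\<^sub>\<infinity> \<cdot> (u)\<^sub>\<infinity> / (A u)\<^sub>\<infinity> = 1\<close>.  Instead of infinite products, the functional
  equations of the two series under \<open>u \<mapsto> q u\<close> are used: they make the product \<open>P Q\<close> invariant under this
  scaling, hence constant.
\<close>
lemma qbinom_convolution:
  assumes q: "\<forall>n>0. q ^ n \<noteq> 1" and AB: "A * B = 1"
  shows "Abs_fps (qbinom q A) * Abs_fps (\<lambda>n. A ^ n * qbinom q B n) = 1"
proof -
  define P where "P = Abs_fps (qbinom q A)"
  define Q where "Q = Abs_fps (\<lambda>n. A ^ n * qbinom q B n)"
  define P' where "P' = Abs_fps (\<lambda>n. q ^ n * qbinom q A n)"
  define Q' where "Q' = Abs_fps (\<lambda>n. q ^ n * (A ^ n * qbinom q B n))"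
  let ?A = "fps_const A * fps_X"
  have P: "(1 - fps_X) * P = (1 - ?A) * P'"
  proof (rule fps_ext)
    fix n
    show "fps_nth ((1 - fps_X) * P) n = fps_nth ((1 - ?A) * P') n"
    proof (cases n)
      case (Suc m)
      then show ?thesis
        using qbinom_Suc[OF q, of m A] by (simp add: P_def P'_def left_diff_distrib mult.assoc) (simp add: algebra_simps)
    qed (simp add: P_def P'_def left_diff_distrib mult.assoc)
  qed
  have Q: "(1 - ?A) * Q = (1 - fps_X) * Q'"
  proof (rule fps_ext)
    fix n
    show "fps_nth ((1 - ?A) * Q) n = fps_nth ((1 - fps_X) * Q') n"
    proof (cases n)
      case (Suc m)
      have "(1 - q * q ^ m) * qbinom q B (Suc m) = (1 - B * q ^ m) * qbinom q B m"
        using qbinom_Suc[OF q, of m B] by simp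
      then have h: "A * (1 - q * q ^ m) * qbinom q B (Suc m) = (A - q ^ m) * qbinom q B m"
      proof -
        have "A * ((1 - B * q ^ m) * qbinom q B m) = (A - A * B * q ^ m) * qbinom q B m"
          by (simp add: algebra_simps)
        then show ?thesis
          using AB \<open>(1 - q * q ^ m) * qbinom q B (Suc m) = _\<close> by (simp add: mult.assoc)
      qed
      have "A * A ^ m * qbinom q B (Suc m) - A * (A ^ m * qbinom q B m)
        = q * q ^ m * (A * A ^ m * qbinom q B (Suc m)) - q ^ m * (A ^ m * qbinom q B m)"
      proof -
        have "A * a * b1 - A * (a * b0) = q * r * (A * a * b1) - r * (a * b0)"
          if "A * (1 - q * r) * b1 = (A - r) * b0" for a b0 b1 r
          using that by algebra
        then show ?thesis using h by blast
      qed
      then show ?thesis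
        using Suc by (simp add: Q_def Q'_def left_diff_distrib mult.assoc)
    qed (simp add: Q_def Q'_def left_diff_distrib mult.assoc)
  qed
  have "((1 - ?A) * (1 - fps_X)) * (P * Q) = ((1 - fps_X) * P) * ((1 - ?A) * Q)"
    by (simp only: mult_ac)
  also have "\<dots> = ((1 - ?A) * (1 - fps_X)) * (P' * Q')"
    unfolding P Q by (simp only: mult_ac)
  finally have eq: "((1 - ?A) * (1 - fps_X)) * (P * Q) = ((1 - ?A) * (1 - fps_X)) * (P' * Q')" .
  have "fps_nth ((1 - ?A) * (1 - fps_X)) 0 \<noteq> 0" by simp
  then have "(1 - ?A) * (1 - fps_X) \<noteq> 0" by (metis fps_zero_nth)
  with eq have PQ: "P * Q = P' * Q'" by simp
  have "fps_nth (P * Q) n = fps_nth 1 n" for n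
  proof (cases "n = 0")
    case False
    have "fps_nth (P' * Q') n = (\<Sum>i=0..n. q ^ n * (fps_nth P i * fps_nth Q (n - i)))"
      unfolding fps_mult_nth
    proof (intro sum.cong refl)
      fix i assume "i \<in> {0..n}"
      then have "q ^ i * q ^ (n - i) = q ^ n" by (simp flip: power_add)
      then show "fps_nth P' i * fps_nth Q' (n - i) = q ^ n * (fps_nth P i * fps_nth Q (n - i))"
        by (simp add: P_def P'_def Q_def Q'_def flip: \<open>q ^ i * q ^ (n - i) = q ^ n\<close>)
    qed
    also have "\<dots> = q ^ n * fps_nth (P * Q) n"
      by (simp add: fps_mult_nth sum_distrib_left)
    finally have "(1 - q ^ n) * fps_nth (P * Q) n = 0" using PQ by (simp add: left_diff_distrib)
    then show ?thesis using q False by simp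
  qed (simp add: P_def Q_def qbinom_def)
  then show ?thesis unfolding P_def Q_def by (simp add: fps_ext)
qed

text \<open>
  When the two multipliers \<open>A\<close> and \<open>B\<close> are reciprocal, the infinite products in the two Euler
  transformations cancel, \<open>F(u) G(A u) = F'(A u) G'(u)\<close>, and comparing coefficients of \<open>u\<^sup>N\<close> gives a transformation of
  convolutions.  Only coefficients up to \<open>N\<close> enter, which is all that the genericity at level
  \<open>N\<close> provides.
\<close>
lemma convolution_transform:
  fixes f g f' g' :: "nat \<Rightarrow> complex"
  assumes q: "\<forall>n>0. q ^ n \<noteq> 1" and AB: "A * B = 1"
    and f: "\<And>K. K \<le> N \<Longrightarrow> f K = (\<Sum>i\<le>K. qbinom q A (K - i) * A ^ i * f' i)"
    and g: "\<And>K. K \<le> N \<Longrightarrow> g K = (\<Sum>i\<le>K. qbinom q B (K - i) * B ^ i * g' i)"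
  shows "(\<Sum>K\<le>N. f K * (A ^ (N - K) * g (N - K))) = (\<Sum>L\<le>N. A ^ L * f' L * g' (N - L))"
proof -
  define P where "P = Abs_fps (qbinom q A)"
  define Q where "Q = Abs_fps (\<lambda>n. A ^ n * qbinom q B n)"
  define U where "U = Abs_fps (\<lambda>n. A ^ n * f' n)"
  define V where "V = Abs_fps g'"
  have fK: "f K = fps_nth (U * P) K" if "K \<le> N" for K
    unfolding f[OF that] fps_mult_nth atMost_atLeast0 by (simp add: U_def P_def mult_ac)
  have gK: "A ^ K * g K = fps_nth (V * Q) K" if "K \<le> N" for K
  proof -
    have "A ^ K * (qbinom q B (K - i) * B ^ i * g' i) = g' i * (A ^ (K - i) * qbinom q B (K - i))" if "i \<le> K" for i
    proof -
      have "A ^ K = A ^ (K - i) * A ^ i" using that by (simp flip: power_add)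
      moreover have "A ^ i * B ^ i = 1" using AB by (simp flip: power_mult_distrib)
      ultimately show ?thesis by (simp add: mult_ac)
    qed
    note eq = this
    have "A ^ K * g K = (\<Sum>i\<le>K. g' i * (A ^ (K - i) * qbinom q B (K - i)))"
      unfolding g[OF that] sum_distrib_left by (intro sum.cong refl eq) simp
    then show ?thesis
      by (simp add: fps_mult_nth atMost_atLeast0 V_def Q_def)
  qed
  have "(\<Sum>K\<le>N. f K * (A ^ (N - K) * g (N - K))) = fps_nth ((U * P) * (V * Q)) N"
    unfolding fps_mult_nth[of "U * P"] atMost_atLeast0
    by (intro sum.cong refl) (simp add: fK gK)
  also have "(U * P) * (V * Q) = (P * Q) * (U * V)" by (simp only: mult_ac)
  also have "P * Q = 1" unfolding P_def Q_def by (rule qbinom_convolution[OF q AB])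
  finally show ?thesis
    by (simp add: fps_mult_nth atMost_atLeast0 U_def V_def)
qed

section \<open>Clearing one denominator\<close>

text \<open>
  This is \<open>(x2 y2)\<^sub>N\<close> times the sum \<open>a1_sum q ps [y1, y2] x1 x2 K\<close>, in a form that keeps its meaning when
  \<open>(x2 y2)\<^sub>N\<close> vanishes.  That case occurs: in the second family \<open>x2 y2 = q\<^sup>1\<^sup>-\<^sup>N/\<phi>\<close>, and
  \<open>(\<phi>)\<^sub>N\<close> enters the final identity only in numerators, so \<open>\<phi> = q\<^sup>-\<^sup>i\<close> with \<open>i < N\<close> is
  permitted.
\<close>
definition a1_cleared :: "complex \<Rightarrow> complex list \<Rightarrow> complex \<Rightarrow> complex \<Rightarrow> complex \<Rightarrow> complex \<Rightarrow> nat \<Rightarrow> nat \<Rightarrow> complex" where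
  "a1_cleared q ps x1 x2 y1 y2 N K = (\<Sum>k\<le>K. let l = K - k in
     (x1 * q ^ k - x2 * q ^ l) / (x1 - x2) *
     (pochs_at q ps x1 k * pochs_at q ps x2 l * qpoch q (x2 * y2 * q ^ l) (N - l)) /
     (qpoch q q k * qpoch q q l * qpoch q (q * x1 / x2) k * qpoch q (q * x2 / x1) l *
      (qpoch q (x1 * y1) k * qpoch q (x1 * y2) k * qpoch q (x2 * y1) l)))"

lemma a1_cleared_eq:
  assumes "qpoch q (x2 * y2) N \<noteq> 0" "K \<le> N"
  shows "a1_cleared q ps x1 x2 y1 y2 N K = qpoch q (x2 * y2) N * a1_sum q ps [y1, y2] x1 x2 K"
proof -
  have "qpoch q (x2 * y2 * q ^ l) (N - l) = qpoch q (x2 * y2) N / qpoch q (x2 * y2) l" if "l \<le> N" for l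
    using qpoch_add[of q "x2 * y2" l "N - l"] that assms(1) by auto
  then have "(x1 * q ^ k - x2 * q ^ l) / (x1 - x2) *
     (pochs_at q ps x1 k * pochs_at q ps x2 l * qpoch q (x2 * y2 * q ^ l) (N - l)) /
     (qpoch q q k * qpoch q q l * qpoch q (q * x1 / x2) k * qpoch q (q * x2 / x1) l *
      (qpoch q (x1 * y1) k * qpoch q (x1 * y2) k * qpoch q (x2 * y1) l))
    = qpoch q (x2 * y2) N * a1_term q ps [y1, y2] x1 x2 k l" if "l \<le> N" for k l
    using that by (simp add: a1_term_def pochs_at_def mult_ac)
  note eq = this
  show ?thesis
    unfolding a1_cleared_def a1_sum_def Let_def sum_distrib_left
    by (intro sum.cong refl, rule eq) (use assms(2) in simp)
qed

lemma continuous_qpoch [continuous_intros]: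
  "continuous F f \<Longrightarrow> continuous F (\<lambda>x. qpoch q (f x) k)"
  unfolding qpoch_def by (intro continuous_intros)

lemma continuous_pochs_at [continuous_intros]:
  "continuous F f \<Longrightarrow> continuous F (\<lambda>x. pochs_at q ps (f x) k)"
  unfolding pochs_at_def
  by (induction ps) (auto intro!: continuous_intros)

lemma continuous_qbinom [continuous_intros]:
  assumes "\<forall>n>0. q ^ n \<noteq> 1"
  shows "isCont f a \<Longrightarrow> isCont (\<lambda>x. qbinom q (f x) k) a"
  unfolding qbinom_def using qpoch_q_nz[OF assms] by (intro continuous_intros) auto

lemma qpoch_nz_mono: "qpoch q a N \<noteq> 0 \<Longrightarrow> k \<le> N \<Longrightarrow> qpoch q a k \<noteq> 0"
  by (auto simp: qpoch_eq_0_iff)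

lemma eventually_qpoch_nz:
  assumes "x \<noteq> 0" "q \<noteq> 0"
  shows "eventually (\<lambda>y. qpoch q (x * y) N \<noteq> 0) (at a)"
proof -
  have "eventually (\<lambda>y. \<forall>i\<in>{..<N}. y \<noteq> 1 / (x * q ^ i)) (at a)"
    by (intro eventually_ball_finite) (auto intro: eventually_neq_at_within)
  then show ?thesis
    by (rule eventually_mono) (use assms in \<open>auto simp: qpoch_eq_0_iff field_simps\<close>)
qed

lemma eventually_q_apart:
  assumes "x \<noteq> 0" "q \<noteq> 0"
  shows "eventually (\<lambda>y. q_apart q x y N) (at a)"
proof -
  have "eventually (\<lambda>y. \<forall>i\<in>{..N}. \<forall>j\<in>{..N}. y \<noteq> x * q ^ i / q ^ j) (at a)"
    by (intro eventually_ball_finite ballI) (auto intro: eventually_neq_at_within)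
  moreover have "eventually (\<lambda>y. y \<noteq> 0) (at a)" by (rule eventually_neq_at_within)
  ultimately show ?thesis
  proof eventually_elim
    case (elim y)
    have "x * q ^ i \<noteq> y * q ^ j" if "i \<le> N" "j \<le> N" for i j
    proof
      assume "x * q ^ i = y * q ^ j"
      then have "y = x * q ^ i / q ^ j" using assms by simp
      with elim(1) that show False by blast
    qed
    then show ?case
      using elim assms by (auto simp: q_apart_def)
  qed
qed

text \<open>
  For \<open>(x2 y2)\<^sub>N \<noteq> 0\<close> this is \<open>a1_sum_euler\<close> multiplied by \<open>(x2 y2)\<^sub>N\<close>, which is the same factor for both
  sums.  Both sides are continuous in \<open>y2\<close>, and only finitely many \<open>y2\<close> are exceptional, so the
  identity extends to the remaining values.
\<close>
lemma a1_cleared_euler: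
  assumes q: "q \<noteq> 0" "\<forall>n>0. q ^ n \<noteq> 1"
    and x: "q_apart q x1 x2 N" and y: "q_apart q y1 y2 N"
    and xy: "qpoch q (x1 * y1) N \<noteq> 0" "qpoch q (x1 * y2) N \<noteq> 0" "qpoch q (x2 * y1) N \<noteq> 0"
    and p: "p1 \<noteq> 0" "p2 \<noteq> 0" "p3 \<noteq> 0" "p4 \<noteq> 0"
    and M: "M \<le> N"
  shows "a1_cleared q [p1, p2, p3, p4] x1 x2 y1 y2 N M
     = (\<Sum>K\<le>M. qbinom q (p1 * p2 * p3 * p4 * x1 * x2 / (y1 * y2)) (M - K) *
          (p1 * p2 * p3 * p4 * x1 * x2 / (y1 * y2)) ^ K * a1_cleared q [1 / p1, 1 / p2, 1 / p3, 1 / p4] y1 y2 x1 x2 N K)"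
  (is "?L y2 = ?R y2")
proof -
  have nz: "x1 \<noteq> 0" "x2 \<noteq> 0" "y1 \<noteq> 0" "y2 \<noteq> 0" "x1 - x2 \<noteq> 0" "y1 - y2 \<noteq> 0"
    using q_apart_nz[OF x] q_apart_nz[OF y] q_apart_neq[OF x] q_apart_neq[OF y] by auto
  have nq: "qpoch q q k \<noteq> 0" for k by (rule qpoch_q_nz[OF q(2)])
  have nx: "qpoch q (q * x1 / x2) k \<noteq> 0" "qpoch q (q * x2 / x1) k \<noteq> 0" if "k \<le> N" for k
    using ratio_poch_nz[OF q(1) x that] ratio_poch_nz[OF q(1) x[unfolded q_apart_sym[of q x1]] that] by auto
  have ny: "qpoch q (q * y1 / y2) k \<noteq> 0" "qpoch q (q * y2 / y1) k \<noteq> 0" if "k \<le> N" for k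
    using ratio_poch_nz[OF q(1) y that] ratio_poch_nz[OF q(1) y[unfolded q_apart_sym[of q y1]] that] by auto
  have nxy: "qpoch q (x1 * y1) k \<noteq> 0" "qpoch q (x1 * y2) k \<noteq> 0" "qpoch q (x2 * y1) k \<noteq> 0"
    "qpoch q (y1 * x1) k \<noteq> 0" "qpoch q (y2 * x1) k \<noteq> 0" "qpoch q (y1 * x2) k \<noteq> 0" if "k \<le> N" for k
    using qpoch_nz_mono[OF xy(1) that] qpoch_nz_mono[OF xy(2) that] qpoch_nz_mono[OF xy(3) that]
    by (simp_all add: mult.commute)
  have cL: "isCont ?L y2"
    unfolding a1_cleared_def Let_def
    using M nz nq nx nxy by (intro continuous_intros) auto
  have cR: "isCont ?R y2"
    unfolding a1_cleared_def Let_def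
    using M nz nq ny nxy by (intro continuous_intros q(2)) auto
  have "eventually (\<lambda>y. ?L y = ?R y) (at y2)"
    using eventually_qpoch_nz[OF nz(1) q(1), of N y2] eventually_qpoch_nz[OF nz(2) q(1), of N y2]
      eventually_q_apart[OF nz(3) q(1), of N y2]
  proof eventually_elim
    case (elim y)
    have "?L y = qpoch q (x2 * y) N * a1_sum q [p1, p2, p3, p4] [y1, y] x1 x2 M"
      by (rule a1_cleared_eq) (use elim M in auto)
    also have "a1_sum q [p1, p2, p3, p4] [y1, y] x1 x2 M
      = (\<Sum>K\<le>M. qbinom q (p1 * p2 * p3 * p4 * x1 * x2 / (y1 * y)) (M - K) *
          (p1 * p2 * p3 * p4 * x1 * x2 / (y1 * y)) ^ K * a1_sum q [1 / p1, 1 / p2, 1 / p3, 1 / p4] [x1, x2] y1 y K)"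
    proof (rule a1_sum_euler[OF q q_apart_mono[OF x M] q_apart_mono[OF elim(3) M] _ _ p])
      show "pochs_at q [y1, y] x1 M \<noteq> 0" "pochs_at q [y1, y] x2 M \<noteq> 0"
        using nxy[OF M] qpoch_nz_mono[OF elim(1) M] qpoch_nz_mono[OF elim(2) M]
        by (simp_all add: pochs_at_def mult.commute)
    qed
    also have "qpoch q (x2 * y) N * \<dots> = ?R y"
      unfolding sum_distrib_left
    proof (intro sum.cong refl)
      fix K assume K: "K \<in> {..M}"
      have e: "a1_cleared q [1 / p1, 1 / p2, 1 / p3, 1 / p4] y1 y x1 x2 N K
         = qpoch q (y * x2) N * a1_sum q [1 / p1, 1 / p2, 1 / p3, 1 / p4] [x1, x2] y1 y K"
        by (rule a1_cleared_eq) (use elim K M in \<open>auto simp: mult.commute\<close>)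
      show "qpoch q (x2 * y) N * (qbinom q (p1 * p2 * p3 * p4 * x1 * x2 / (y1 * y)) (M - K) *
          (p1 * p2 * p3 * p4 * x1 * x2 / (y1 * y)) ^ K * a1_sum q [1 / p1, 1 / p2, 1 / p3, 1 / p4] [x1, x2] y1 y K)
         = qbinom q (p1 * p2 * p3 * p4 * x1 * x2 / (y1 * y)) (M - K) *
          (p1 * p2 * p3 * p4 * x1 * x2 / (y1 * y)) ^ K * a1_cleared q [1 / p1, 1 / p2, 1 / p3, 1 / p4] y1 y x1 x2 N K"
        unfolding e by (simp only: mult_ac)
    qed
    finally show ?case .
  qed
  then have "(?L \<longlongrightarrow> ?R y2) (at y2)"
    using cR unfolding isCont_def by (subst tendsto_cong)
  with cL show ?thesis
    unfolding isCont_def using tendsto_unique[OF at_neq_bot] by blast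
qed

section \<open>From pair sums to very-well-poised series\<close>

text \<open>
  The factor that appears when a shifted factorial is read backwards, up to the power of its
  argument.  It does not depend on that argument, so it cancels between equally many numerators and
  denominators.
\<close>
definition rev_factor :: "complex \<Rightarrow> nat \<Rightarrow> nat \<Rightarrow> complex" where
  "rev_factor q l k = (\<Prod>i<k. - (q ^ (l + i)))"

lemma rev_factor_nz: "q \<noteq> 0 \<Longrightarrow> rev_factor q l k \<noteq> 0"
  by (simp add: rev_factor_def)

lemma rev_factor_split: "rev_factor q 0 (l + k) = rev_factor q 0 l * rev_factor q l k"
  by (induction k) (simp_all add: rev_factor_def)

lemma rev_factor_square: "rev_factor q 0 k ^ 2 * q ^ k = (q ^ k) ^ k"
proof (induction k)
  case (Suc k)
  have "rev_factor q 0 (Suc k) ^ 2 * q ^ Suc k = (rev_factor q 0 k ^ 2 * q ^ k) * (q ^ k * q ^ Suc k)"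
    by (simp add: rev_factor_def power2_eq_square)
  also have "\<dots> = (q ^ Suc k) ^ Suc k"
    unfolding Suc by (simp add: power_mult_distrib)
  finally show ?case .
qed (simp add: rev_factor_def)

lemma qpoch_reverse:
  assumes "q \<noteq> 0" "a \<noteq> 0"
  shows "qpoch q (a * q ^ l) k = qpoch q (q powi (1 - int (l + k)) / a) k * a ^ k * rev_factor q l k"
proof -
  have "qpoch q (q powi (1 - int (l + k)) / a) k = (\<Prod>i<k. 1 - q powi (1 - int (l + k)) / a * q ^ (k - Suc i))"
    unfolding qpoch_def by (rule prod.nat_diff_reindex[symmetric])
  also have "\<dots> * a ^ k * rev_factor q l k = (\<Prod>i<k. (1 - q powi (1 - int (l + k)) / a * q ^ (k - Suc i)) * a * - (q ^ (l + i)))"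
    by (simp only: rev_factor_def prod.distrib prod_constant card_lessThan)
  also have "\<dots> = (\<Prod>i<k. 1 - a * q ^ l * q ^ i)"
  proof (intro prod.cong refl)
    fix i assume "i \<in> {..<k}"
    then have i: "1 - int (l + k) + int (k - Suc i) + int (l + i) = 0" by auto
    have "q powi (1 - int (l + k)) * q ^ (k - Suc i) * q ^ (l + i) = q powi (1 - int (l + k) + int (k - Suc i) + int (l + i))"
    proof -
      have "q powi (m + n) = q powi m * q powi n" for m n
        using assms by (simp add: power_int_add)
      then show ?thesis by (simp only: power_int_of_nat)
    qed
    also have "\<dots> = 1" unfolding i by simp
    finally have "q powi (1 - int (l + k)) * q ^ (k - Suc i) * q ^ (l + i) = 1" .
    moreover have "(1 - P / a * Q) * a * - R = P * Q * R - a * R" for P Q R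
      using assms by (simp add: field_simps)
    ultimately show "(1 - q powi (1 - int (l + k)) / a * q ^ (k - Suc i)) * a * - (q ^ (l + i)) = 1 - a * q ^ l * q ^ i"
      by (simp add: power_add mult.assoc)
  qed
  finally show ?thesis by (simp add: qpoch_def)
qed

lemma qpoch_reverse_add:
  assumes "q \<noteq> 0" "a \<noteq> 0"
  shows "qpoch q a (l + k) = qpoch q a l * (qpoch q (q powi (1 - int (l + k)) / a) k * a ^ k * rev_factor q l k)"
  unfolding qpoch_add qpoch_reverse[OF assms] ..

text \<open>
  The field-arithmetic core of \<open>a1_cleared_eq_vwp\<close>.  Each capital pair \<open>XL\<close>, \<open>XY\<close> stands for the two parts of a
  reversed shifted factorial of length \<open>K\<close>; the hypothesis \<open>P\<close> converts \<open>(q/t)\<^sub>K\<close> into \<open>(1/t)\<^sub>K\<close> and the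
  hypothesis \<open>pw\<close> is the balance of powers that fixes the argument of the series.
\<close>
lemma a1_cleared_term_alg:
  fixes BY QY EY TY r :: complex
  assumes nz: "BY \<noteq> 0" "QY \<noteq> 0" "EY \<noteq> 0" "TY \<noteq> 0" "r \<noteq> 0" "P \<noteq> 0" "c \<noteq> 0" "c' \<noteq> 0" "TL \<noteq> 0" "qk \<noteq> 0" "ek \<noteq> 0" "tk \<noteq> 0"
    and P: "P * (z * qK) * c = c' * (TL * (TY * tk * r))"
    and pw: "bk * uk * qK = ql * fk * qk * ek * tk"
  shows "z * ql * D / c' * (Bk * BL * (FY * fk * r * S)) / (Qk * QL * Uk * TL * (Vk * Wk * EL))
    = (BL * (BY * bk * r ^ 4)) / ((QL * (QY * qk * r)) * P * (EL * (EY * ek * r))) * S *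
      (D / c * ((TY * (Bk * (EY * (FY * QY)))) / (Qk * (BY * (Vk * (Wk * Uk))))) * uk)"
proof -
  have Pc: "inverse P * inverse c = z * qK * inverse c' * inverse TL * inverse TY * inverse tk * inverse r"
    using P nz by (simp add: field_simps)
  have pw': "bk * uk * qK * inverse qk * inverse ek * inverse tk = ql * fk"
    unfolding pw using nz by (simp add: field_simps)
  define T where "T = z * D * inverse c' * Bk * BL * FY * S * inverse Qk * inverse QL * inverse Uk * inverse TL * inverse Vk * inverse Wk * inverse EL"
  have "(BL * (BY * bk * r ^ 4)) / ((QL * (QY * qk * r)) * P * (EL * (EY * ek * r))) * S *
      (D / c * ((TY * (Bk * (EY * (FY * QY)))) / (Qk * (BY * (Vk * (Wk * Uk))))) * uk)
    = (BY * inverse BY) * (QY * inverse QY) * (EY * inverse EY) * (r * inverse r) * (r * inverse r)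
      * (inverse P * inverse c) * (TY * r * r * BL * bk * inverse QL * inverse qk * inverse EL * inverse ek * S * D * Bk * FY * inverse Qk * inverse Vk * inverse Wk * inverse Uk * uk)"
    by (simp only: divide_inverse inverse_mult_distrib power4_eq_xxxx mult_ac)
  also have "\<dots> = (inverse P * inverse c) * (TY * r * r * BL * bk * inverse QL * inverse qk * inverse EL * inverse ek * S * D * Bk * FY * inverse Qk * inverse Vk * inverse Wk * inverse Uk * uk)"
    using nz by simp
  also have "\<dots> = (TY * inverse TY) * (r * inverse r) * (r * T) * (bk * uk * qK * inverse qk * inverse ek * inverse tk)"
    unfolding Pc T_def by (simp only: mult_ac)
  also have "\<dots> = r * T * (ql * fk)"
    unfolding pw' using nz by simp
  also have "\<dots> = z * ql * D / c' * (Bk * BL * (FY * fk * r * S)) / (Qk * QL * Uk * TL * (Vk * Wk * EL))"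
    unfolding T_def by (simp only: divide_inverse inverse_mult_distrib mult_ac)
  finally show ?thesis ..
qed

text \<open>
  In the term with indices \<open>k\<close> and \<open>l = K - k\<close> every factor of length \<open>l\<close> is reversed into a factor of
  length \<open>k\<close> over one of length \<open>K\<close>.  The powers of \<open>q\<close> quadratic in \<open>k\<close> cancel, and the linear
  ones combine to the argument \<open>t\<^sup>3 q\<^sup>3 / (b c d1 d2 e f)\<close>.
\<close>
lemma a1_cleared_eq_vwp:
  assumes q: "q \<noteq> 0" "\<forall>n>0. q ^ n \<noteq> 1"
    and nz: "t \<noteq> 0" "b \<noteq> 0" "c \<noteq> 0" "d1 \<noteq> 0" "d2 \<noteq> 0" "e \<noteq> 0" "f \<noteq> 0"
    and x: "q_apart q 1 (1 / t) N" and K: "K \<le> N"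
    and p: "qpochs q [b / t, c / t, d1 / t, d2 / t] K \<noteq> 0" "qpoch q (q / e) K \<noteq> 0"
  shows "a1_cleared q [b, c, d1, d2] 1 (1 / t) (t * q / e) (t * q / f) N K
    = qpochs q [b / t, c / t, d1 / t, d2 / t] K / qpochs q [q, 1 / t, q / e] K * qpoch q (q / f * q ^ K) (N - K) *
      vwp_series q (t * q powi (- int K)) [b, c, d1, d2, e * q powi (- int K), f * q powi (- int K), q powi (- int K)]
        (t ^ 3 * q ^ 3 / (b * c * d1 * d2 * e * f))"
proof -
  define a where "a = t * q powi (- int K)"
  define u where "u = t ^ 3 * q ^ 3 / (b * c * d1 * d2 * e * f)"
  have qK: "q powi (1 - int K) = q powi (- int K) * q"
    using q(1) power_int_add[of q "- int K" 1] by simp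
  have t1: "1 - 1 / t \<noteq> 0" using q_apart_neq[OF x] by auto
  have a1: "1 - a \<noteq> 0"
    using q_apartD[OF x, of 0 K] K nz q by (auto simp: a_def power_int_minus field_simps)
  have P: "qpoch q (1 / t) K \<noteq> 0"
    using q_apartD[OF x, of 0 "_"] K by (auto simp: qpoch_eq_0_iff)
  have qt: "qpoch q (q / t) K \<noteq> 0"
    using q_apartD[OF x, of 0 "Suc _"] K by (auto simp: qpoch_eq_0_iff mult_ac)
  have PP: "qpoch q (1 / t) K * (- (1 / t) * q ^ K) * (1 - a) = (1 - 1 / t) * qpoch q (q / t) K"
  proof -
    have "(- (1 / t) * q ^ K) * (1 - a) = 1 - 1 / t * q ^ K"
      using nz q by (simp add: a_def power_int_minus field_simps)
    moreover have "qpoch q (1 / t) K * (1 - 1 / t * q ^ K) = (1 - 1 / t) * qpoch q (q / t) K"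
      using qpoch_Suc[of q "1 / t" K] qpoch_Suc_shift[of q "1 / t" K] by simp
    ultimately show ?thesis
      by (simp only: mult.assoc)
  qed
  have W: "vwp_series q a [b, c, d1, d2, e * q powi (- int K), f * q powi (- int K), q powi (- int K)] u
     = (\<Sum>k\<le>K. vwp_term q a [b, c, d1, d2, e * q powi (- int K), f * q powi (- int K), q powi (- int K)] u k)"
    using vwp_series_terminating[OF q(1), of a "[b, c, d1, d2, e * q powi (- int K), f * q powi (- int K)]" K u] by simp
  show ?thesis
    unfolding a1_cleared_def Let_def a_def[symmetric] u_def[symmetric] W sum_distrib_left
  proof (intro sum.cong refl)
    fix k assume k: "k \<in> {..K}"
    define l where "l = K - k"
    have Kl: "K = l + k" using k by (simp add: l_def)
    define r where "r = rev_factor q l k"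
    have rev: "qpoch q z K = qpoch q z l * (qpoch q (q powi (- int K) * q / z) k * z ^ k * r)" if "z \<noteq> 0" for z
      using qpoch_reverse_add[OF q(1) that, of l k] unfolding r_def Kl[symmetric] qK .
    have r: "r \<noteq> 0" using rev_factor_nz[OF q(1)] by (simp add: r_def)
    have rev_b: "qpoch q (z / t) K = qpoch q (z / t) l * (qpoch q (a * q / z) k * (z / t) ^ k * r)" if "z \<noteq> 0" for z
      using rev[of "z / t"] that nz by (simp add: a_def mult_ac)
    have rev_q: "qpoch q q K = qpoch q q l * (qpoch q (q powi (- int K)) k * q ^ k * r)"
      using rev[of q] q by simp
    have rev_e: "qpoch q (q / z) K = qpoch q (q / z) l * (qpoch q (z * q powi (- int K)) k * (q / z) ^ k * r)" if "z \<noteq> 0" for z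
      using rev[of "q / z"] that q by (simp add: mult_ac)
    have rev_t: "qpoch q (q / t) K = qpoch q (q / t) l * (qpoch q a k * (q / t) ^ k * r)"
      using rev_e[of t] nz by (simp add: a_def)
    have G: "qpoch q (q / f * q ^ l) (N - l) = qpoch q (f * q powi (- int K)) k * (q / f) ^ k * r * qpoch q (q / f * q ^ K) (N - K)"
    proof -
      have "N - l = k + (N - K)" using K Kl by simp
      then have "qpoch q (q / f * q ^ l) (N - l) = qpoch q (q / f * q ^ l) k * qpoch q (q / f * q ^ K) (N - K)"
        by (simp add: qpoch_add Kl power_add mult.assoc)
      also have "qpoch q (q / f * q ^ l) k = qpoch q (f * q powi (- int K)) k * (q / f) ^ k * r"
        using qpoch_reverse[OF q(1), of "q / f" l k] q nz unfolding r_def Kl[symmetric] qK by (simp add: mult_ac)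
      finally show ?thesis .
    qed
    define BL where "BL = qpoch q (b / t) l * qpoch q (c / t) l * qpoch q (d1 / t) l * qpoch q (d2 / t) l"
    define BY where "BY = qpoch q (a * q / b) k * qpoch q (a * q / c) k * qpoch q (a * q / d1) k * qpoch q (a * q / d2) k"
    define bk where "bk = (b / t) ^ k * (c / t) ^ k * (d1 / t) ^ k * (d2 / t) ^ k"
    define Bk where "Bk = qpoch q b k * qpoch q c k * qpoch q d1 k * qpoch q d2 k"
    have BK: "qpochs q [b / t, c / t, d1 / t, d2 / t] K = BL * (BY * bk * r ^ 4)"
      using nz by (simp add: rev_b BL_def BY_def bk_def power4_eq_xxxx mult_ac)
    have BY: "BY \<noteq> 0" using p(1) unfolding BK by auto
    have QY: "qpoch q (q powi (- int K)) k \<noteq> 0" using qpoch_q_nz[OF q(2), of K] unfolding rev_q by auto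
    have EY: "qpoch q (e * q powi (- int K)) k \<noteq> 0" using p(2) unfolding rev_e[OF nz(6)] by auto
    have TY: "qpoch q a k \<noteq> 0" "qpoch q (q / t) l \<noteq> 0" using qt unfolding rev_t by auto
    have D: "1 * q ^ k - 1 / t * q ^ l = - (1 / t) * q ^ l * (1 - a * q ^ (2 * k))"
    proof -
      have e1: "q powi (- int K) * q ^ K = 1" using q by (simp add: power_int_minus)
      have e2: "q ^ l * q ^ (2 * k) = q ^ K * q ^ k" by (simp add: Kl mult_2 power_add)
      have "- (1 / t) * q ^ l * (1 - a * q ^ (2 * k)) = (a / t) * (q ^ l * q ^ (2 * k)) - 1 / t * q ^ l"
        by (simp add: algebra_simps)
      also have "(a / t) * (q ^ l * q ^ (2 * k)) = (q powi (- int K) * q ^ K) * q ^ k"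
        unfolding e2 using nz by (simp add: a_def)
      finally show ?thesis unfolding e1 by simp
    qed
    have pw: "bk * u ^ k * q ^ K = q ^ l * (q / f) ^ k * q ^ k * (q / e) ^ k * (q / t) ^ k"
    proof -
      have "b / t * (c / t) * (d1 / t) * (d2 / t) * u * q = q / f * q * (q / e) * (q / t)"
        using nz q by (simp add: u_def field_simps power3_eq_cube)
      then have "bk * u ^ k * q ^ k = (q / f) ^ k * q ^ k * (q / e) ^ k * (q / t) ^ k"
        unfolding bk_def power_mult_distrib[symmetric] by simp
      then show ?thesis unfolding Kl power_add using q(1) by (simp add: mult_ac)
    qed
    have "(1 * q ^ k - 1 / t * q ^ l) / (1 - 1 / t) *
       (pochs_at q [b, c, d1, d2] 1 k * pochs_at q [b, c, d1, d2] (1 / t) l * qpoch q (1 / t * (t * q / f) * q ^ l) (N - l)) /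
       (qpoch q q k * qpoch q q l * qpoch q (q * 1 / (1 / t)) k * qpoch q (q * (1 / t) / 1) l *
        (qpoch q (1 * (t * q / e)) k * qpoch q (1 * (t * q / f)) k * qpoch q (1 / t * (t * q / e)) l))
      = - (1 / t) * q ^ l * (1 - a * q ^ (2 * k)) / (1 - 1 / t) *
        (Bk * BL * (qpoch q (f * q powi (- int K)) k * (q / f) ^ k * r * qpoch q (q / f * q ^ K) (N - K))) /
        (qpoch q q k * qpoch q q l * qpoch q (t * q) k * qpoch q (q / t) l * (qpoch q (t * q / e) k * qpoch q (t * q / f) k * qpoch q (q / e) l))"
      unfolding D G[symmetric] using nz by (simp add: Bk_def BL_def pochs_at_def mult_ac)
    also have "\<dots> = (BL * (BY * bk * r ^ 4)) / ((qpoch q q l * (qpoch q (q powi (- int K)) k * q ^ k * r)) * qpoch q (1 / t) K * (qpoch q (q / e) l * (qpoch q (e * q powi (- int K)) k * (q / e) ^ k * r))) * qpoch q (q / f * q ^ K) (N - K) *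
      ((1 - a * q ^ (2 * k)) / (1 - a) * ((qpoch q a k * (Bk * (qpoch q (e * q powi (- int K)) k * (qpoch q (f * q powi (- int K)) k * qpoch q (q powi (- int K)) k)))) / (qpoch q q k * (BY * (qpoch q (t * q / e) k * (qpoch q (t * q / f) k * qpoch q (t * q) k))))) * u ^ k)"
      by (rule a1_cleared_term_alg[OF BY QY EY TY(1) r P a1 t1 TY(2) _ _ _ _ pw])
        (use q nz PP[unfolded rev_t] in auto)
    also have "\<dots> = qpochs q [b / t, c / t, d1 / t, d2 / t] K / qpochs q [q, 1 / t, q / e] K * qpoch q (q / f * q ^ K) (N - K) *
       vwp_term q a [b, c, d1, d2, e * q powi (- int K), f * q powi (- int K), q powi (- int K)] u k"
    proof -
      have "a * q / (z * q powi (- int K)) = t * q / z" "a * q / q powi (- int K) = t * q" for z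
        using q by (simp_all add: a_def)
      then show ?thesis
        unfolding BK[symmetric] rev_q[symmetric] rev_e[OF nz(6), symmetric]
        by (simp add: vwp_term_def Bk_def BY_def mult_ac)
    qed
    finally show "(1 * q ^ k - 1 / t * q ^ (K - k)) / (1 - 1 / t) *
       (pochs_at q [b, c, d1, d2] 1 k * pochs_at q [b, c, d1, d2] (1 / t) (K - k) * qpoch q (1 / t * (t * q / f) * q ^ (K - k)) (N - (K - k))) /
       (qpoch q q k * qpoch q q (K - k) * qpoch q (q * 1 / (1 / t)) k * qpoch q (q * (1 / t) / 1) (K - k) *
        (qpoch q (1 * (t * q / e)) k * qpoch q (1 * (t * q / f)) k * qpoch q (1 / t * (t * q / e)) (K - k))) =
       qpochs q [b / t, c / t, d1 / t, d2 / t] K / qpochs q [q, 1 / t, q / e] K * qpoch q (q / f * q ^ K) (N - K) *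
       vwp_term q a [b, c, d1, d2, e * q powi (- int K), f * q powi (- int K), q powi (- int K)] u k"
      unfolding l_def .
  qed
qed

text \<open>
  The sums depend only on the products \<open>p x\<close>, \<open>x y\<close> and on \<open>x1 / x2\<close>.  Rescaling so that the first
  variable is \<open>1\<close>, the dual sum is again of the shape in \<open>a1_cleared_eq_vwp\<close>, with \<open>t\<close>, \<open>e\<close>, \<open>f\<close> replaced by
  \<open>f/e\<close>, \<open>f/t\<close>, \<open>f\<close>.
\<close>
lemma a1_cleared_dual:
  assumes nz: "q \<noteq> 0" "t \<noteq> 0" "e \<noteq> 0" "f \<noteq> 0"
  shows "a1_cleared q [1 / b, 1 / c, 1 / d1, 1 / d2] (t * q / e) (t * q / f) 1 (1 / t) N K
   = a1_cleared q [t * q / (b * e), t * q / (c * e), t * q / (d1 * e), t * q / (d2 * e)] 1 (1 / (f / e))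
       (f / e * q / (f / t)) (f / e * q / f) N K"
proof -
  have "(t * q / e * q ^ k - t * q / f * q ^ l) / (t * q / e - t * q / f) = (1 * q ^ k - 1 / (f / e) * q ^ l) / (1 - 1 / (f / e))" for k l
  proof -
    have "t * q / e * q ^ k - t * q / f * q ^ l = (t * q / e) * (1 * q ^ k - 1 / (f / e) * q ^ l)" "t * q / e - t * q / f = (t * q / e) * (1 - 1 / (f / e))"
      using nz by (simp_all add: field_simps)
    then show ?thesis using nz by simp
  qed
  moreover have "q * (t * q / e) / (t * q / f) = q * 1 / (1 / (f / e))" "q * (t * q / f) / (t * q / e) = q * (1 / (f / e)) / 1"
    "t * q / e * 1 = 1 * (f / e * q / (f / t))" "t * q / e * (1 / t) = 1 * (f / e * q / f)"
    "t * q / f * 1 = 1 / (f / e) * (f / e * q / (f / t))" "t * q / f * (1 / t) = 1 / (f / e) * (f / e * q / f)"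
    "1 / z * (t * q / e) = t * q / (z * e) * 1" "1 / z * (t * q / f) = t * q / (z * e) * (1 / (f / e))" for z
    using nz by (simp_all add: mult_ac)
  ultimately show ?thesis
    unfolding a1_cleared_def Let_def pochs_at_def list.map by (simp only:)
qed

text \<open>
  The coefficients of index \<open>K\<close> in the final identity are those of \<open>a1_cleared_eq_vwp\<close> with total index
  \<open>M = N - K\<close> up to a constant and a geometric factor.  The numerator \<open>(v)\<^sub>K\<close> is reversed on its own,
  because \<open>(v)\<^sub>N\<close> may vanish.
\<close>
lemma reverse_coefficients:
  assumes q: "q \<noteq> 0" and nz: "a1 \<noteq> 0" "a2 \<noteq> 0" "v \<noteq> 0" "b1 \<noteq> 0" "b2 \<noteq> 0" "b3 \<noteq> 0" "b4 \<noteq> 0"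
    and N: "N = K + M"
    and p: "qpochs q [q, a1, a2] N \<noteq> 0" "qpochs q [b1, b2, b3, b4] N \<noteq> 0"
  defines "Q \<equiv> q powi (1 - int N)"
  shows "qpochs q [a1, a2, v, q powi (- int N)] K / qpochs q [b1, b2, b3, b4] K * q ^ K
    = q ^ N * (qpochs q [a1, a2, q powi (- int N)] N * v ^ N * rev_factor q 0 N / qpochs q [b1, b2, b3, b4] N)
      * (b1 * b2 * b3 * b4 / (a1 * a2 * v * Q)) ^ M
      * (qpochs q [Q / b1, Q / b2, Q / b3, Q / b4] M / qpochs q [q, Q / a1, Q / a2] M * qpoch q (q powi (1 - int K) / v) K)"
proof -
  define n where "n = q powi (- int N)"
  define R where "R = rev_factor q K M"
  have nq: "n * q = Q" using q power_int_add[of q "- int N" 1] by (simp add: n_def Q_def)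
  have n0: "n \<noteq> 0" and Q0: "Q \<noteq> 0" using q by (simp_all add: n_def Q_def)
  have R: "R \<noteq> 0" using rev_factor_nz[OF q] by (simp add: R_def)
  have rev: "qpoch q z N = qpoch q z K * (qpoch q (Q / z) M * z ^ M * R)" if "z \<noteq> 0" for z
    using qpoch_reverse_add[OF q that, of K M] unfolding R_def Q_def N .
  have rev_v: "qpoch q v K = qpoch q (q powi (1 - int K) / v) K * v ^ K * rev_factor q 0 K"
    using qpoch_reverse[OF q nz(3), of 0 K] by simp
  have A: "qpoch q (Q / a1) M \<noteq> 0" "qpoch q (Q / a2) M \<noteq> 0"
    using p(1) by (auto simp: rev nz)
  have "qpoch q q M \<noteq> 0" using p(1) N qpoch_nz_mono[of q q N M] by simp
  have B: "qpoch q (Q / b1) M \<noteq> 0" "qpoch q (Q / b2) M \<noteq> 0" "qpoch q (Q / b3) M \<noteq> 0" "qpoch q (Q / b4) M \<noteq> 0"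
    using p(2) by (auto simp: rev nz)
  have "Q / n = q" using nq n0 by (simp add: field_simps)
  with rev[OF n0] have rev_n: "qpoch q n N = qpoch q n K * (qpoch q q M * n ^ M * R)" by simp
  define aM where "aM = a1 ^ M * a2 ^ M * v ^ M * n ^ M * q ^ M"
  define bM where "bM = b1 ^ M * b2 ^ M * b3 ^ M * b4 ^ M"
  have M0: "aM \<noteq> 0" "bM \<noteq> 0" using nz q n0 by (simp_all add: aM_def bM_def)
  have pw: "(b1 * b2 * b3 * b4 / (a1 * a2 * v * Q)) ^ M = bM / aM"
    unfolding nq[symmetric] by (simp add: power_mult_distrib power_divide aM_def bM_def mult_ac)
  define A where "A = qpoch q q M * qpoch q (Q / a1) M * qpoch q (Q / a2) M"
  define B where "B = qpoch q (Q / b1) M * qpoch q (Q / b2) M * qpoch q (Q / b3) M * qpoch q (Q / b4) M"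
  define AK where "AK = qpoch q a1 K * qpoch q a2 K * qpoch q n K"
  define BK where "BK = qpoch q b1 K * qpoch q b2 K * qpoch q b3 K * qpoch q b4 K"
  have AB: "A \<noteq> 0" "B \<noteq> 0" using A B \<open>qpoch q q M \<noteq> 0\<close> by (simp_all add: A_def B_def)
  have "q ^ N * (qpochs q [a1, a2, n] N * v ^ N * rev_factor q 0 N / qpochs q [b1, b2, b3, b4] N)
    = q ^ K * ((AK * A * R ^ 4) * v ^ K * rev_factor q 0 K * aM / (BK * B * R ^ 4 * bM))"
    unfolding N power_add rev_factor_split R_def[symmetric]
    unfolding N[symmetric] by (simp add: rev rev_n nz aM_def bM_def A_def B_def AK_def BK_def power4_eq_xxxx mult_ac)
  moreover have "qpochs q [Q / b1, Q / b2, Q / b3, Q / b4] M / qpochs q [q, Q / a1, Q / a2] M = B / A"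
    by (simp add: A_def B_def mult_ac)
  moreover have "qpochs q [a1, a2, v, n] K / qpochs q [b1, b2, b3, b4] K
     = AK * (qpoch q (q powi (1 - int K) / v) K * v ^ K * rev_factor q 0 K) / BK"
    by (simp add: rev_v AK_def BK_def mult_ac)
  ultimately show ?thesis
    unfolding pw n_def[symmetric] using AB M0 R by simp
qed

section \<open>Genericity conditions\<close>

lemma q_apart_scale: "s \<noteq> 0 \<Longrightarrow> q_apart q (s * x1) (s * x2) N \<longleftrightarrow> q_apart q x1 x2 N"
  by (simp add: q_apart_def mult.assoc)

text \<open>
  The condition on \<open>1 - a\<^sub>0\<close> excludes the non-negative powers \<open>t = q\<^sup>i\<close>, and the factor
  \<open>(t q)\<^sub>N\<close>, which stems from the terminating parameter \<open>q\<^sup>-\<^sup>N\<close>, excludes the negative ones.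
\<close>
lemma q_apart_one_inverse:
  assumes q: "q \<noteq> 0" and t: "t \<noteq> 0"
    and lo: "\<And>K. K \<le> N \<Longrightarrow> t * q powi (- int K) \<noteq> 1"
    and hi: "qpoch q (t * q) N \<noteq> 0"
  shows "q_apart q 1 (1 / t) N"
  unfolding q_apart_def
proof (intro conjI allI impI)
  fix i j assume ij: "i \<le> N" "j \<le> N"
  show "1 * q ^ i \<noteq> 1 / t * q ^ j"
  proof
    assume "1 * q ^ i = 1 / t * q ^ j"
    then have eq: "t * q ^ i = q ^ j" using t by (simp add: field_simps)
    show False
    proof (cases "i \<le> j")
      case True
      then have "q ^ j = q ^ i * q ^ (j - i)" by (simp flip: power_add)
      with eq q have "t = q ^ (j - i)" by simp
      moreover have "j - i \<le> N" using ij by linarith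
      ultimately show False using lo[of "j - i"] q by (simp add: power_int_minus)
    next
      case False
      then have "q ^ i = q ^ j * (q * q ^ (i - j - 1))"
        by (simp flip: power_add power_Suc)
      with eq q have "t * q * q ^ (i - j - 1) = 1" by (simp add: mult_ac)
      then show False using hi False ij unfolding qpoch_eq_0_iff by fastforce
    qed
  qed
qed (use t in auto)

lemma vwp_generic:
  assumes q: "q \<noteq> 0" and nz: "t \<noteq> 0" "b \<noteq> 0" "c \<noteq> 0" "d1 \<noteq> 0" "d2 \<noteq> 0"
    and V: "\<forall>K\<le>N. vwp_nonvanishing q (t * q powi (- int K))
      [b, c, d1, d2, e * q powi (- int K), f * q powi (- int K), q powi (- int K)] K"
  shows "q_apart q 1 (1 / t) N" "qpochs q [b / t, c / t, d1 / t, d2 / t] N \<noteq> 0"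
    "qpoch q (t * q / e) N \<noteq> 0" "qpoch q (t * q / f) N \<noteq> 0"
proof -
  have e: "t * q powi (- int N) * q / (z * q powi (- int N)) = t * q / z" "t * q powi (- int N) * q / q powi (- int N) = t * q" for z
    using q by simp_all
  have *: "qpoch q (t * q powi (- int N) * q / z) N \<noteq> 0" if "z \<in> {b, c, d1, d2}" for z
    using V[rule_format, OF order.refl] that by (auto simp: vwp_nonvanishing_def)
  have **: "qpoch q (t * q / e) N \<noteq> 0" "qpoch q (t * q / f) N \<noteq> 0" "qpoch q (t * q) N \<noteq> 0"
    using V[rule_format, OF order.refl] by (auto simp: vwp_nonvanishing_def e)
  then show "qpoch q (t * q / e) N \<noteq> 0" "qpoch q (t * q / f) N \<noteq> 0" by auto
  show "q_apart q 1 (1 / t) N"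
    by (rule q_apart_one_inverse[OF q nz(1) _ **(3)]) (use V in \<open>auto simp: vwp_nonvanishing_def\<close>)
  have qN: "q powi (1 - int N) = q powi (- int N) * q"
    using q power_int_add[of q "- int N" 1] by simp
  have "qpoch q (z / t) N \<noteq> 0" if "z \<in> {b, c, d1, d2}" "z \<noteq> 0" for z
    using qpoch_reverse[OF q, of "z / t" 0 N] *[OF that(1)] that(2) nz(1) rev_factor_nz[OF q]
    by (simp add: qN mult_ac)
  then show "qpochs q [b / t, c / t, d1 / t, d2 / t] N \<noteq> 0" using nz by simp
qed

lemma qpochs_nz_mono: "qpochs q as N \<noteq> 0 \<Longrightarrow> K \<le> N \<Longrightarrow> qpochs q as K \<noteq> 0"
  by (induction as) (auto dest: qpoch_nz_mono)

text \<open>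
  The Euler transformation together with the evaluation of both of its sums as
  \<open>\<^sub>1\<^sub>0W\<^sub>9\<close> series.  The hypotheses complement each other: \<open>(q/e)\<^sub>N \<noteq> 0\<close> is used for the sum on the left
  but comes from the dual series.
\<close>
lemma a1_cleared_pair:
  assumes q: "q \<noteq> 0" "\<forall>n>0. q ^ n \<noteq> 1"
    and nz: "t \<noteq> 0" "b \<noteq> 0" "c \<noteq> 0" "d1 \<noteq> 0" "d2 \<noteq> 0" "e \<noteq> 0" "f \<noteq> 0"
    and V: "\<forall>K\<le>N. vwp_nonvanishing q (t * q powi (- int K))
      [b, c, d1, d2, e * q powi (- int K), f * q powi (- int K), q powi (- int K)] K"
    and V': "\<forall>K\<le>N. vwp_nonvanishing q (f / e * q powi (- int K))
      [t * q / (b * e), t * q / (c * e), t * q / (d1 * e), t * q / (d2 * e), f / t * q powi (- int K), f * q powi (- int K), q powi (- int K)] K"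
    and K: "K \<le> N"
  defines "A \<equiv> b * c * d1 * d2 * e * f / (t ^ 3 * q ^ 2)"
  shows "a1_cleared q [b, c, d1, d2] 1 (1 / t) (t * q / e) (t * q / f) N K
     = (\<Sum>L\<le>K. qbinom q A (K - L) * A ^ L * a1_cleared q [1 / b, 1 / c, 1 / d1, 1 / d2] (t * q / e) (t * q / f) 1 (1 / t) N L)"
    (is ?euler)
   and "a1_cleared q [b, c, d1, d2] 1 (1 / t) (t * q / e) (t * q / f) N K
    = qpochs q [b / t, c / t, d1 / t, d2 / t] K / qpochs q [q, 1 / t, q / e] K * qpoch q (q / f * q ^ K) (N - K) *
      vwp_series q (t * q powi (- int K)) [b, c, d1, d2, e * q powi (- int K), f * q powi (- int K), q powi (- int K)]
        (t ^ 3 * q ^ 3 / (b * c * d1 * d2 * e * f))"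
    (is ?primal)
   and "a1_cleared q [1 / b, 1 / c, 1 / d1, 1 / d2] (t * q / e) (t * q / f) 1 (1 / t) N K
    = qpochs q [t * q / (b * f), t * q / (c * f), t * q / (d1 * f), t * q / (d2 * f)] K / qpochs q [q, e / f, t * q / f] K *
      qpoch q (q / f * q ^ K) (N - K) *
      vwp_series q (f / e * q powi (- int K))
        [t * q / (b * e), t * q / (c * e), t * q / (d1 * e), t * q / (d2 * e), f / t * q powi (- int K), f * q powi (- int K), q powi (- int K)]
        (b * c * d1 * d2 * e * f / (t ^ 3 * q))"
    (is ?dual)
proof -
  have nz': "f / e \<noteq> 0" "f / t \<noteq> 0" "t * q / (b * e) \<noteq> 0" "t * q / (c * e) \<noteq> 0" "t * q / (d1 * e) \<noteq> 0" "t * q / (d2 * e) \<noteq> 0"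
    using nz q by simp_all
  note G = vwp_generic[OF q(1) nz(1-5) V]
  note G' = vwp_generic[OF q(1) nz'(1,3-6) V']
  have r: "f / e * q / (f / t) = t * q / e" "f / e * q / f = q / e" "q / (f / t) = t * q / f"
    using nz by simp_all
  have qe: "qpoch q (q / e) N \<noteq> 0" using G'(4) unfolding r .
  have y: "q_apart q (t * q / e) (t * q / f) N"
  proof -
    have "t * q / e * 1 = t * q / e" "t * q / e * (1 / (f / e)) = t * q / f" using nz by simp_all
    then show ?thesis using q_apart_scale[of "t * q / e" q 1 "1 / (f / e)" N] G'(1) nz q by simp
  qed
  have A: "b * c * d1 * d2 * 1 * (1 / t) / (t * q / e * (t * q / f)) = A"
    using nz q by (simp add: A_def power3_eq_cube power2_eq_square field_simps)
  have "qpoch q (1 * (t * q / e)) N \<noteq> 0" "qpoch q (1 * (t * q / f)) N \<noteq> 0" "qpoch q (1 / t * (t * q / e)) N \<noteq> 0"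
    using G(3,4) qe nz by simp_all
  from a1_cleared_euler[OF q G(1) y this nz(2-5) K] show ?euler
    unfolding A .
  show ?primal
    by (rule a1_cleared_eq_vwp[OF q nz G(1) K qpochs_nz_mono[OF G(2) K] qpoch_nz_mono[OF qe K]])
  have qe': "qpoch q (q / (f / t)) K \<noteq> 0" unfolding r using qpoch_nz_mono[OF G(4) K] .
  have u: "(f / e) ^ 3 * q ^ 3 / (t * q / (b * e) * (t * q / (c * e)) * (t * q / (d1 * e)) * (t * q / (d2 * e)) * (f / t) * f)
    = b * c * d1 * d2 * e * f / (t ^ 3 * q)"
    using nz q by (simp add: power3_eq_cube field_simps)
  have s: "t * q / (z * e) / (f / e) = t * q / (z * f)" "1 / (f / e) = e / f" for z using nz by simp_all
  show ?dual
    unfolding a1_cleared_dual[OF q(1) nz(1,6,7)]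
    using a1_cleared_eq_vwp[OF q nz'(1,3-6,2) nz(7) G'(1) K qpochs_nz_mono[OF G'(2) K] qe']
    unfolding u s r .
qed

lemma vwp_series_swap: "vwp_series q a0 (x # y # as) u = vwp_series q a0 (y # x # as) u"
  by (simp add: vwp_series_def vwp_term_def mult_ac)

lemma vwp_nonvanishing_swap: "vwp_nonvanishing q a0 (x # y # as) M \<longleftrightarrow> vwp_nonvanishing q a0 (y # x # as) M"
  by (simp add: vwp_nonvanishing_def mult_ac)

section \<open>The transformation of sums of products\<close>

theorem mainTheorem2:
  fixes q t b c d1 d2 e f \<sigma> \<beta> \<gamma> \<delta>1 \<delta>2 \<epsilon> \<phi> :: complex
    and N :: nat
  assumes "0 < cmod q" "cmod q < 1"
    and "t \<noteq> 0" "b \<noteq> 0" "c \<noteq> 0" "d1 \<noteq> 0" "d2 \<noteq> 0" "e \<noteq> 0" "f \<noteq> 0" "\<sigma> \<noteq> 0" "\<beta> \<noteq> 0" "\<gamma> \<noteq> 0" "\<delta>1 \<noteq> 0" "\<delta>2 \<noteq> 0" "\<epsilon> \<noteq> 0" "\<phi> \<noteq> 0"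
    and "t ^ 3 * \<sigma> ^ 3 * q ^ (N + 4) =
           b * c * d1 * d2 * e * f * \<beta> * \<gamma> * \<delta>1 * \<delta>2 * \<epsilon> * \<phi>"
    and "\<And>K. K \<le> N \<Longrightarrow> qpochs q [q, 1 / t, q / e, q / f, \<sigma> * q / \<beta>, \<sigma> * q / \<gamma>, \<sigma> * q / \<delta>1, \<sigma> * q / \<delta>2] K \<noteq> 0"
    and "\<And>K. K \<le> N \<Longrightarrow> vwp_nonvanishing q (t * q powi (- int K))
      [b, c, d1, d2, e * q powi (- int K), f * q powi (- int K), q powi (- int K)] (K)"
    and "\<And>K. K \<le> N \<Longrightarrow> vwp_nonvanishing q (\<sigma> * q ^ K)
      [\<beta>, \<gamma>, \<delta>1, \<delta>2, \<epsilon> * q ^ K, \<phi> * q ^ K, q powi (int K - int N)] (N - K)"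
    and "qpochs q [\<sigma> * q / \<delta>1, \<sigma> * q / \<delta>2, \<epsilon> / \<phi>, \<sigma> * q / \<gamma>, \<sigma> * q / \<phi>, \<sigma> * q / \<beta>] N \<noteq> 0"
    and "\<And>L. L \<le> N \<Longrightarrow>
      qpochs q [q, e / f, t * q / f, q / f, q powi (- int N) * \<gamma> * \<phi> / \<sigma>, q powi (- int N) * \<beta> * \<phi> / \<sigma>, q powi (- int N) * \<delta>1 * \<phi> / \<sigma>,
                    q powi (- int N) * \<delta>2 * \<phi> / \<sigma>] L \<noteq> 0"
    and "\<And>L. L \<le> N \<Longrightarrow> vwp_nonvanishing q (q powi (- int L) * f / e)
      [t * q / (c * e), t * q / (b * e), t * q / (d1 * e), t * q / (d2 * e), f * q powi (- int L) / t, f * q powi (- int L), q powi (- int L)] (L)"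
    and "\<And>L. L \<le> N \<Longrightarrow> vwp_nonvanishing q (q powi (int L - int N) * \<phi> / \<epsilon>)
      [\<sigma> * q / (\<gamma> * \<epsilon>), \<sigma> * q / (\<beta> * \<epsilon>), \<sigma> * q / (\<delta>1 * \<epsilon>), \<sigma> * q / (\<delta>2 * \<epsilon>), q powi (int L - int N) * \<phi> / \<sigma>, q ^ L * \<phi>, q powi (int L - int N)] (N - L)"
  shows
    "(\<Sum>K=0..N.
        qpochs q [b / t, c / t, d1 / t, d2 / t, \<sigma> * q, \<epsilon>, \<phi>, q powi (- int N)] K
        / qpochs q [q, 1 / t, q / e, q / f, \<sigma> * q / \<beta>, \<sigma> * q / \<gamma>, \<sigma> * q / \<delta>1, \<sigma> * q / \<delta>2] K
        * q ^ K
        * vwp_series q (t * q powi (- int K))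
            [b, c, d1, d2, e * q powi (- int K), f * q powi (- int K), q powi (- int K)]
            (t ^ 3 * q ^ 3 / (b * c * d1 * d2 * e * f))
        * vwp_series q (\<sigma> * q ^ K)
            [\<beta>, \<gamma>, \<delta>1, \<delta>2, \<epsilon> * q ^ K, \<phi> * q ^ K, q powi (int K - int N)]
            (\<sigma> ^ 3 * q ^ (N + 3) / (\<beta> * \<gamma> * \<delta>1 * \<delta>2 * \<epsilon> * \<phi>)))
     = \<phi> ^ N
       * (qpochs q [\<sigma> * q / (\<delta>1 * \<phi>), \<sigma> * q / (\<delta>2 * \<phi>), \<epsilon>, \<sigma> * q / (\<gamma> * \<phi>), \<sigma> * q, \<sigma> * q / (\<beta> * \<phi>)] N
          / qpochs q [\<sigma> * q / \<delta>1, \<sigma> * q / \<delta>2, \<epsilon> / \<phi>, \<sigma> * q / \<gamma>, \<sigma> * q / \<phi>, \<sigma> * q / \<beta>] N)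
       * (\<Sum>L=0..N.
        qpochs q [t * q / (c * f), t * q / (b * f), t * q / (d1 * f), t * q / (d2 * f),
                  q powi (1 - int N) * \<phi> / \<epsilon>, q powi (- int N) * \<phi> / \<sigma>, \<phi>, q powi (- int N)] L
        / qpochs q [q, e / f, t * q / f, q / f, q powi (- int N) * \<gamma> * \<phi> / \<sigma>, q powi (- int N) * \<beta> * \<phi> / \<sigma>, q powi (- int N) * \<delta>1 * \<phi> / \<sigma>,
                    q powi (- int N) * \<delta>2 * \<phi> / \<sigma>] L
        * q ^ L
        * vwp_series q (q powi (- int L) * f / e)
            [t * q / (c * e), t * q / (b * e), t * q / (d1 * e), t * q / (d2 * e), f * q powi (- int L) / t, f * q powi (- int L), q powi (- int L)]
            (b * c * d1 * d2 * e * f * q powi (-1) / t ^ 3)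
        * vwp_series q (q powi (int L - int N) * \<phi> / \<epsilon>)
            [\<sigma> * q / (\<gamma> * \<epsilon>), \<sigma> * q / (\<beta> * \<epsilon>), \<sigma> * q / (\<delta>1 * \<epsilon>), \<sigma> * q / (\<delta>2 * \<epsilon>), q powi (int L - int N) * \<phi> / \<sigma>, q ^ L * \<phi>, q powi (int L - int N)]
            (\<beta> * \<gamma> * \<delta>1 * \<delta>2 * \<epsilon> * \<phi> * q powi (- int N - 1) / \<sigma> ^ 3))"
proof -
  note V = assms(19) and VG = assms(20) and VF' = assms(23) and VG' = assms(24)
  have q: "q \<noteq> 0" using assms(1) by auto
  have q1: "\<forall>n>0. q ^ n \<noteq> 1"
  proof (intro allI impI notI)
    fix n :: nat assume "0 < n" "q ^ n = 1"
    moreover have "cmod q ^ n < 1" using assms(1,2) \<open>0 < n\<close> by (simp add: power_less_one_iff)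
    ultimately show False by (simp flip: norm_power)
  qed
  note nz = assms(3-16)
  define Z where "Z = q ^ N"
  have Z: "Z \<noteq> 0" using q by (simp add: Z_def)
  have qm: "q powi (- int k) = 1 / q ^ k" for k
    using q by (simp add: power_int_minus field_simps)
  have q1m: "q powi (1 - int k) = q / q ^ k" for k
    using q by (simp add: power_int_diff)
  have split: "q powi (int K - int N) = q powi (- int (N - K))" if "K \<le> N" for K
    using that by (simp add: of_nat_diff)
  have up: "Z * q powi (- int (N - K)) = q ^ K" if "K \<le> N" for K
  proof -
    have "Z = q ^ K * q ^ (N - K)" using that by (simp add: Z_def flip: power_add)
    then show ?thesis using q by (simp add: qm)
  qed
  have comm: "z * Z * q powi (- int (N - K)) = z * q ^ K" if "K \<le> N" for z K
    using up[OF that] by (simp add: mult.assoc)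
  define A where "A = b * c * d1 * d2 * e * f / (t ^ 3 * q ^ 2)"
  define B where "B = \<beta> * \<gamma> * \<delta>1 * \<delta>2 * (\<epsilon> * Z) * (\<phi> * Z) / ((\<sigma> * Z) ^ 3 * q ^ 2)"
  have A0: "A \<noteq> 0" using nz q by (simp add: A_def)
  have bal: "t ^ 3 * \<sigma> ^ 3 * (Z * q ^ 4) = b * c * d1 * d2 * e * f * \<beta> * \<gamma> * \<delta>1 * \<delta>2 * \<epsilon> * \<phi>"
    using assms(17) by (simp add: Z_def power_add)
  have AB: "A * B = 1"
  proof -
    have "A * B = (b * c * d1 * d2 * e * f * \<beta> * \<gamma> * \<delta>1 * \<delta>2 * \<epsilon> * \<phi>) / (t ^ 3 * \<sigma> ^ 3 * (Z * q ^ 4))"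
      using nz q Z by (simp add: A_def B_def field_simps power3_eq_cube power2_eq_square power4_eq_xxxx)
    also have "\<dots> = 1" unfolding bal[symmetric] using nz q Z by simp
    finally show ?thesis .
  qed
  \<comment> \<open>The second family has the shape of the first one with \<open>\<sigma> q\<^sup>N\<close>, \<open>\<epsilon> q\<^sup>N\<close>, \<open>\<phi> q\<^sup>N\<close> in place of
    \<open>t\<close>, \<open>e\<close>, \<open>f\<close> and total index \<open>M = N - K\<close>; then \<open>\<sigma> q\<^sup>K = (\<sigma> q\<^sup>N) q\<^sup>-\<^sup>M\<close> is its base.\<close>
  define ff where "ff = a1_cleared q [b, c, d1, d2] 1 (1 / t) (t * q / e) (t * q / f) N"
  define ff' where "ff' = a1_cleared q [1 / b, 1 / c, 1 / d1, 1 / d2] (t * q / e) (t * q / f) 1 (1 / t) N"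
  define gg where "gg = a1_cleared q [\<beta>, \<gamma>, \<delta>1, \<delta>2] 1 (1 / (\<sigma> * Z)) (\<sigma> * Z * q / (\<epsilon> * Z)) (\<sigma> * Z * q / (\<phi> * Z)) N"
  define gg' where "gg' = a1_cleared q [1 / \<beta>, 1 / \<gamma>, 1 / \<delta>1, 1 / \<delta>2] (\<sigma> * Z * q / (\<epsilon> * Z)) (\<sigma> * Z * q / (\<phi> * Z)) 1 (1 / (\<sigma> * Z)) N"
  have V_all: "\<forall>K\<le>N. vwp_nonvanishing q (t * q powi (- int K))
      [b, c, d1, d2, e * q powi (- int K), f * q powi (- int K), q powi (- int K)] K"
    using V by blast
  have VF'_all: "\<forall>L\<le>N. vwp_nonvanishing q (f / e * q powi (- int L))
      [t * q / (b * e), t * q / (c * e), t * q / (d1 * e), t * q / (d2 * e), f / t * q powi (- int L), f * q powi (- int L), q powi (- int L)] L"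
  proof (intro allI impI)
    fix L assume L: "L \<le> N"
    show "vwp_nonvanishing q (f / e * q powi (- int L))
      [t * q / (b * e), t * q / (c * e), t * q / (d1 * e), t * q / (d2 * e), f / t * q powi (- int L), f * q powi (- int L), q powi (- int L)] L"
      using VF'[OF L] by (subst vwp_nonvanishing_swap) (simp add: mult_ac)
  qed
  note F = a1_cleared_pair[OF q q1 nz(1-7) V_all VF'_all, folded A_def ff_def ff'_def]
  have VG_all: "\<forall>M\<le>N. vwp_nonvanishing q (\<sigma> * Z * q powi (- int M))
      [\<beta>, \<gamma>, \<delta>1, \<delta>2, \<epsilon> * Z * q powi (- int M), \<phi> * Z * q powi (- int M), q powi (- int M)] M"
  proof (intro allI impI)
    fix M assume "M \<le> N"
    then have K: "N - M \<le> N" "N - (N - M) = M" by auto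
    show "vwp_nonvanishing q (\<sigma> * Z * q powi (- int M))
      [\<beta>, \<gamma>, \<delta>1, \<delta>2, \<epsilon> * Z * q powi (- int M), \<phi> * Z * q powi (- int M), q powi (- int M)] M"
      using VG[OF K(1)] unfolding comm[OF K(1), symmetric] split[OF K(1)] K(2) .
  qed
  have VG'_all: "\<forall>M\<le>N. vwp_nonvanishing q (\<phi> * Z / (\<epsilon> * Z) * q powi (- int M))
      [\<sigma> * Z * q / (\<beta> * (\<epsilon> * Z)), \<sigma> * Z * q / (\<gamma> * (\<epsilon> * Z)), \<sigma> * Z * q / (\<delta>1 * (\<epsilon> * Z)), \<sigma> * Z * q / (\<delta>2 * (\<epsilon> * Z)),
       \<phi> * Z / (\<sigma> * Z) * q powi (- int M), \<phi> * Z * q powi (- int M), q powi (- int M)] M"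
  proof (intro allI impI)
    fix M assume "M \<le> N"
    then have K: "N - M \<le> N" "N - (N - M) = M" by auto
    have s: "\<phi> * Z / (z * Z) = \<phi> / z" "\<sigma> * Z * q / (y * (\<epsilon> * Z)) = \<sigma> * q / (y * \<epsilon>)" for y z
      using Z by simp_all
    have s': "q powi (- int M) * \<phi> / z = \<phi> / z * q powi (- int M)" for z
      by simp
    have c: "q ^ (N - M) * \<phi> = \<phi> * Z * q powi (- int M)"
      using comm[OF K(1), of \<phi>] unfolding K(2) by (simp only: mult.commute)
    show "vwp_nonvanishing q (\<phi> * Z / (\<epsilon> * Z) * q powi (- int M))
      [\<sigma> * Z * q / (\<beta> * (\<epsilon> * Z)), \<sigma> * Z * q / (\<gamma> * (\<epsilon> * Z)), \<sigma> * Z * q / (\<delta>1 * (\<epsilon> * Z)), \<sigma> * Z * q / (\<delta>2 * (\<epsilon> * Z)),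
       \<phi> * Z / (\<sigma> * Z) * q powi (- int M), \<phi> * Z * q powi (- int M), q powi (- int M)] M"
      using VG'[OF K(1)] unfolding split[OF K(1)] K(2) s s' c
      by (subst vwp_nonvanishing_swap)
  qed
  have nzG: "\<sigma> * Z \<noteq> 0" "\<epsilon> * Z \<noteq> 0" "\<phi> * Z \<noteq> 0" using nz Z by simp_all
  note G = a1_cleared_pair[OF q q1 nzG(1) nz(9-12) nzG(2,3) VG_all VG'_all, folded B_def gg_def gg'_def]
  have conv: "(\<Sum>K\<le>N. ff K * (A ^ (N - K) * gg (N - K))) = (\<Sum>L\<le>N. A ^ L * ff' L * gg' (N - L))"
    by (rule convolution_transform[OF q1 AB F(1) G(1)])
  have PSQ: "qpoch q (\<sigma> * q) N \<noteq> 0"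
  proof -
    have "\<sigma> * q * q ^ i \<noteq> 1" if "i < N" for i
      using VG[of "Suc i"] that by (simp add: vwp_nonvanishing_def mult.assoc)
    then show ?thesis by (simp add: qpoch_eq_0_iff)
  qed
  \<comment> \<open>The dual series of the second family has \<open>q\<^sup>1\<^sup>-\<^sup>N/\<epsilon>\<close> among its denominator parameters.\<close>
  have PE: "qpoch q \<epsilon> N \<noteq> 0"
  proof -
    have "qpoch q (q powi (- int N) * \<phi> / \<epsilon> * q / (q ^ 0 * \<phi>)) N \<noteq> 0"
      using VG'[of 0] by (simp add: vwp_nonvanishing_def)
    moreover have "q powi (- int N) * \<phi> / \<epsilon> * q / (q ^ 0 * \<phi>) = q powi (1 - int N) / \<epsilon>"
      using nz by (simp add: qm q1m)
    ultimately show ?thesis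
      using qpoch_reverse[OF q nz(13), of 0 N] nz rev_factor_nz[OF q] by simp
  qed
  have qN: "qpoch q q N \<noteq> 0" by (rule qpoch_q_nz[OF q1])
  define fN where "fN = qpoch q (q / f) N"
  have fN: "fN \<noteq> 0" using assms(18)[of N] by (simp add: fN_def)
  have tail: "qpoch q (q / f) K * qpoch q (q / f * q ^ K) (N - K) = fN" if "K \<le> N" for K
    using qpoch_add[of q "q / f" K "N - K"] that by (simp add: fN_def)
  have Q: "q powi (1 - int N) = q / Z" "q powi (- int N) = 1 / Z"
    by (simp_all add: qm q1m Z_def)
  have tailG: "q powi (1 - int K) / \<phi> = q / (\<phi> * Z) * q ^ (N - K)" if "K \<le> N" for K
  proof -
    have "Z = q ^ K * q ^ (N - K)" using that by (simp add: Z_def flip: power_add)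
    then show ?thesis using q nz by (simp add: q1m)
  qed
  define C1 where "C1 = Z * (qpochs q [\<sigma> * q, \<epsilon>, 1 / Z] N * \<phi> ^ N * rev_factor q 0 N / qpochs q [\<sigma> * q / \<beta>, \<sigma> * q / \<gamma>, \<sigma> * q / \<delta>1, \<sigma> * q / \<delta>2] N)"
  have rc1: "qpochs q [\<sigma> * q, \<epsilon>, \<phi>, 1 / Z] K / qpochs q [\<sigma> * q / \<beta>, \<sigma> * q / \<gamma>, \<sigma> * q / \<delta>1, \<sigma> * q / \<delta>2] K * q ^ K
      = C1 * A ^ (N - K) * (qpochs q [\<beta> / (\<sigma> * Z), \<gamma> / (\<sigma> * Z), \<delta>1 / (\<sigma> * Z), \<delta>2 / (\<sigma> * Z)] (N - K)
        / qpochs q [q, 1 / (\<sigma> * Z), q / (\<epsilon> * Z)] (N - K) * qpoch q (q / (\<phi> * Z) * q ^ (N - K)) K)"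
    if K: "K \<le> N" for K
  proof -
    have "\<sigma> * q / \<beta> * (\<sigma> * q / \<gamma>) * (\<sigma> * q / \<delta>1) * (\<sigma> * q / \<delta>2) / (\<sigma> * q * \<epsilon> * \<phi> * (q / Z)) = 1 / B"
      using nz q Z by (simp add: B_def field_simps power3_eq_cube power2_eq_square)
    also have "\<dots> = A" using AB by (metis nonzero_eq_divide_eq mult_zero_right zero_neq_one)
    finally have ratio: "\<sigma> * q / \<beta> * (\<sigma> * q / \<gamma>) * (\<sigma> * q / \<delta>1) * (\<sigma> * q / \<delta>2) / (\<sigma> * q * \<epsilon> * \<phi> * (q / Z)) = A" .
    have s: "q / Z / (\<sigma> * q / z) = z / (\<sigma> * Z)" "q / Z / (\<sigma> * q) = 1 / (\<sigma> * Z)" "q / Z / \<epsilon> = q / (\<epsilon> * Z)" for z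
      using nz q by (simp_all add: mult_ac)
    have n: "\<sigma> * q \<noteq> 0" "\<epsilon> \<noteq> 0" "\<phi> \<noteq> 0" "\<sigma> * q / \<beta> \<noteq> 0" "\<sigma> * q / \<gamma> \<noteq> 0" "\<sigma> * q / \<delta>1 \<noteq> 0" "\<sigma> * q / \<delta>2 \<noteq> 0"
      using nz q by simp_all
    have "N = K + (N - K)" "qpochs q [q, \<sigma> * q, \<epsilon>] N \<noteq> 0" "qpochs q [\<sigma> * q / \<beta>, \<sigma> * q / \<gamma>, \<sigma> * q / \<delta>1, \<sigma> * q / \<delta>2] N \<noteq> 0"
      using K PSQ PE qN assms(21) by simp_all
    from reverse_coefficients[OF q n this, unfolded Q s ratio Z_def[symmetric] tailG[OF K]]
    show ?thesis unfolding C1_def .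
  qed
  define C2 where "C2 = Z * (qpochs q [q / Z * \<phi> / \<epsilon>, 1 / Z * \<phi> / \<sigma>, 1 / Z] N * \<phi> ^ N * rev_factor q 0 N
     / qpochs q [1 / Z * \<gamma> * \<phi> / \<sigma>, 1 / Z * \<beta> * \<phi> / \<sigma>, 1 / Z * \<delta>1 * \<phi> / \<sigma>, 1 / Z * \<delta>2 * \<phi> / \<sigma>] N)"
  have bN: "qpochs q [1 / Z * \<gamma> * \<phi> / \<sigma>, 1 / Z * \<beta> * \<phi> / \<sigma>, 1 / Z * \<delta>1 * \<phi> / \<sigma>, 1 / Z * \<delta>2 * \<phi> / \<sigma>] N \<noteq> 0"
    using assms(22)[OF order.refl] unfolding Q by simp
  have n2: "q / Z * \<phi> / \<epsilon> \<noteq> 0" "1 / Z * \<phi> / \<sigma> \<noteq> 0" "\<phi> \<noteq> 0" "1 / Z * \<gamma> * \<phi> / \<sigma> \<noteq> 0" "1 / Z * \<beta> * \<phi> / \<sigma> \<noteq> 0" "1 / Z * \<delta>1 * \<phi> / \<sigma> \<noteq> 0" "1 / Z * \<delta>2 * \<phi> / \<sigma> \<noteq> 0"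
    using nz q Z by simp_all
  have s2: "q / Z / (1 / Z * z * \<phi> / \<sigma>) = \<sigma> * q / (z * \<phi>)" "q / Z / (q / Z * \<phi> / \<epsilon>) = \<epsilon> / \<phi>" "q / Z / (1 / Z * \<phi> / \<sigma>) = \<sigma> * q / \<phi>" for z
    using nz q Z by (simp_all add: mult_ac)
  have revN: "qpoch q z N = qpoch q (q / Z / z) N * z ^ N * rev_factor q 0 N" if "z \<noteq> 0" for z
    using qpoch_reverse[OF q that, of 0 N] by (simp add: Q)
  have aN: "qpochs q [q, q / Z * \<phi> / \<epsilon>, 1 / Z * \<phi> / \<sigma>] N \<noteq> 0"
    unfolding qpochs_Cons qpochs_Nil revN[OF n2(1)] revN[OF n2(2)] s2
    using qN assms(21) nz q Z rev_factor_nz[OF q] by simp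
  have ratio2: "1 / Z * \<gamma> * \<phi> / \<sigma> * (1 / Z * \<beta> * \<phi> / \<sigma>) * (1 / Z * \<delta>1 * \<phi> / \<sigma>) * (1 / Z * \<delta>2 * \<phi> / \<sigma>)
      / (q / Z * \<phi> / \<epsilon> * (1 / Z * \<phi> / \<sigma>) * \<phi> * (q / Z)) = 1 / A"
  proof -
    have "1 / Z * \<gamma> * \<phi> / \<sigma> * (1 / Z * \<beta> * \<phi> / \<sigma>) * (1 / Z * \<delta>1 * \<phi> / \<sigma>) * (1 / Z * \<delta>2 * \<phi> / \<sigma>)
      / (q / Z * \<phi> / \<epsilon> * (1 / Z * \<phi> / \<sigma>) * \<phi> * (q / Z)) = B"
      using nz q Z by (simp add: B_def field_simps power3_eq_cube power2_eq_square)
    also have "B = 1 / A" using AB A0 by (simp add: field_simps)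
    finally show ?thesis .
  qed
  have rc2: "qpochs q [q / Z * \<phi> / \<epsilon>, 1 / Z * \<phi> / \<sigma>, \<phi>, 1 / Z] L / qpochs q [1 / Z * \<gamma> * \<phi> / \<sigma>, 1 / Z * \<beta> * \<phi> / \<sigma>, 1 / Z * \<delta>1 * \<phi> / \<sigma>, 1 / Z * \<delta>2 * \<phi> / \<sigma>] L * q ^ L
      = C2 * (1 / A) ^ (N - L) * (qpochs q [\<sigma> * q / (\<gamma> * \<phi>), \<sigma> * q / (\<beta> * \<phi>), \<sigma> * q / (\<delta>1 * \<phi>), \<sigma> * q / (\<delta>2 * \<phi>)] (N - L)
        / qpochs q [q, \<epsilon> / \<phi>, \<sigma> * q / \<phi>] (N - L) * qpoch q (q / (\<phi> * Z) * q ^ (N - L)) L)"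
    if L: "L \<le> N" for L
  proof -
    have "N = L + (N - L)" using L by simp
    from reverse_coefficients[OF q n2 this aN bN, unfolded Q s2 ratio2 Z_def[symmetric] tailG[OF L]]
    show ?thesis unfolding C2_def .
  qed
  define C where "C = \<phi> ^ N
       * (qpochs q [\<sigma> * q / (\<delta>1 * \<phi>), \<sigma> * q / (\<delta>2 * \<phi>), \<epsilon>, \<sigma> * q / (\<gamma> * \<phi>), \<sigma> * q, \<sigma> * q / (\<beta> * \<phi>)] N
          / qpochs q [\<sigma> * q / \<delta>1, \<sigma> * q / \<delta>2, \<epsilon> / \<phi>, \<sigma> * q / \<gamma>, \<sigma> * q / \<phi>, \<sigma> * q / \<beta>] N)"
  \<comment> \<open>Reversal over the full length \<open>N\<close> identifies the constants of the two sides.\<close>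
  have CC: "C * C2 = C1 * A ^ N"
  proof -
    define r where "r = rev_factor q 0 N"
    define a where "a = q / Z * \<phi> / \<epsilon> * (1 / Z * \<phi> / \<sigma>) * \<phi>"
    define p where "p = 1 / Z * \<gamma> * \<phi> / \<sigma> * (1 / Z * \<beta> * \<phi> / \<sigma>) * (1 / Z * \<delta>1 * \<phi> / \<sigma>) * (1 / Z * \<delta>2 * \<phi> / \<sigma>)"
    define E where "E = qpoch q (\<epsilon> / \<phi>) N * qpoch q (\<sigma> * q / \<phi>) N"
    define D where "D = qpochs q [\<sigma> * q / \<beta>, \<sigma> * q / \<gamma>, \<sigma> * q / \<delta>1, \<sigma> * q / \<delta>2] N"
    define G where "G = qpochs q [\<sigma> * q / (\<gamma> * \<phi>), \<sigma> * q / (\<beta> * \<phi>), \<sigma> * q / (\<delta>1 * \<phi>), \<sigma> * q / (\<delta>2 * \<phi>)] N"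
    define H where "H = qpoch q (\<sigma> * q) N * qpoch q \<epsilon> N"
    define n where "n = qpoch q (1 / Z) N"
    have r0: "r \<noteq> 0" using rev_factor_nz[OF q] by (simp add: r_def)
    have ap0: "a \<noteq> 0" "p \<noteq> 0" using n2 by (simp_all add: a_def p_def)
    have E0: "E \<noteq> 0" using assms(21) by (simp add: E_def)
    have num: "qpochs q [q / Z * \<phi> / \<epsilon>, 1 / Z * \<phi> / \<sigma>, 1 / Z] N * \<phi> ^ N = E * n * a ^ N * r ^ 2"
      unfolding qpochs_Cons qpochs_Nil revN[OF n2(1)] revN[OF n2(2)] s2 a_def power_mult_distrib E_def n_def r_def power2_eq_square
      by (simp only: mult_ac mult_1_left mult_1_right)
    have den: "qpochs q [1 / Z * \<gamma> * \<phi> / \<sigma>, 1 / Z * \<beta> * \<phi> / \<sigma>, 1 / Z * \<delta>1 * \<phi> / \<sigma>, 1 / Z * \<delta>2 * \<phi> / \<sigma>] N = G * p ^ N * r ^ 4"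
      unfolding qpochs_Cons qpochs_Nil revN[OF n2(4)] revN[OF n2(5)] revN[OF n2(6)] revN[OF n2(7)] s2 p_def power_mult_distrib G_def r_def power4_eq_xxxx
      by (simp only: mult_ac mult_1_left mult_1_right)
    have G0: "G \<noteq> 0" using bN unfolding den by simp
    have C2: "C2 = Z * (E * n * a ^ N * r ^ 2 * r / (G * p ^ N * r ^ 4))"
      unfolding C2_def num den r_def ..
    have C: "C = \<phi> ^ N * (G * H / (D * E))"
      by (simp add: C_def G_def H_def D_def E_def mult_ac)
    have C1: "C1 = Z * (H * n * \<phi> ^ N * r / D)"
      by (simp add: C1_def H_def n_def D_def r_def mult_ac)
    have "p / (a * (q / Z)) = 1 / A" using ratio2 unfolding a_def p_def .
    then have "a = A * p * (Z / q)" using ap0 A0 q Z by (simp add: field_simps)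
    then have "a ^ N = A ^ N * p ^ N * (Z ^ N / q ^ N)"
      by (simp add: power_mult_distrib power_divide)
    also have "Z ^ N / q ^ N = r ^ 2"
      using rev_factor_square[of q N] q by (simp add: Z_def r_def field_simps)
    finally have aN: "a ^ N = A ^ N * p ^ N * r ^ 2" .
    have "C * C2 = C1 * (E / E) * (G / G) * (p ^ N / p ^ N) * (r ^ 4 / r ^ 4) * A ^ N"
      unfolding C C2 C1 aN
      by (simp only: divide_inverse inverse_mult_distrib power4_eq_xxxx power2_eq_square mult_ac)
    then show ?thesis using E0 G0 ap0 r0 by simp
  qed
  have LHS: "(\<Sum>K\<le>N.
        qpochs q [b / t, c / t, d1 / t, d2 / t, \<sigma> * q, \<epsilon>, \<phi>, q powi (- int N)] K
        / qpochs q [q, 1 / t, q / e, q / f, \<sigma> * q / \<beta>, \<sigma> * q / \<gamma>, \<sigma> * q / \<delta>1, \<sigma> * q / \<delta>2] K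
        * q ^ K
        * vwp_series q (t * q powi (- int K))
            [b, c, d1, d2, e * q powi (- int K), f * q powi (- int K), q powi (- int K)]
            (t ^ 3 * q ^ 3 / (b * c * d1 * d2 * e * f))
        * vwp_series q (\<sigma> * q ^ K)
            [\<beta>, \<gamma>, \<delta>1, \<delta>2, \<epsilon> * q ^ K, \<phi> * q ^ K, q powi (int K - int N)]
            (\<sigma> ^ 3 * q ^ (N + 3) / (\<beta> * \<gamma> * \<delta>1 * \<delta>2 * \<epsilon> * \<phi>)))
     = C1 / fN * (\<Sum>K\<le>N. ff K * (A ^ (N - K) * gg (N - K)))"
    unfolding sum_distrib_left
  proof (intro sum.cong refl)
    fix K assume "K \<in> {..N}"
    then have K: "K \<le> N" "N - K \<le> N" "N - (N - K) = K" by auto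
    have u: "(\<sigma> * Z) ^ 3 * q ^ 3 / (\<beta> * \<gamma> * \<delta>1 * \<delta>2 * (\<epsilon> * Z) * (\<phi> * Z)) = \<sigma> ^ 3 * q ^ (N + 3) / (\<beta> * \<gamma> * \<delta>1 * \<delta>2 * \<epsilon> * \<phi>)"
      unfolding power_add Z_def[symmetric] using Z nz by (simp add: field_simps power3_eq_cube)
    define W1 where "W1 = vwp_series q (t * q powi (- int K))
            [b, c, d1, d2, e * q powi (- int K), f * q powi (- int K), q powi (- int K)]
            (t ^ 3 * q ^ 3 / (b * c * d1 * d2 * e * f))"
    define W2 where "W2 = vwp_series q (\<sigma> * q ^ K)
            [\<beta>, \<gamma>, \<delta>1, \<delta>2, \<epsilon> * q ^ K, \<phi> * q ^ K, q powi (- int (N - K))]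
            (\<sigma> ^ 3 * q ^ (N + 3) / (\<beta> * \<gamma> * \<delta>1 * \<delta>2 * \<epsilon> * \<phi>))"
    note fK = F(2)[OF K(1), folded W1_def]
    note gK = G(2)[OF K(2), unfolded comm[OF K(1)] K(3) u, folded W2_def]
    have "qpochs q [b / t, c / t, d1 / t, d2 / t, \<sigma> * q, \<epsilon>, \<phi>, 1 / Z] K
        / qpochs q [q, 1 / t, q / e, q / f, \<sigma> * q / \<beta>, \<sigma> * q / \<gamma>, \<sigma> * q / \<delta>1, \<sigma> * q / \<delta>2] K
        * q ^ K
      = qpochs q [b / t, c / t, d1 / t, d2 / t] K / qpochs q [q, 1 / t, q / e] K / qpoch q (q / f) K
       * (qpochs q [\<sigma> * q, \<epsilon>, \<phi>, 1 / Z] K / qpochs q [\<sigma> * q / \<beta>, \<sigma> * q / \<gamma>, \<sigma> * q / \<delta>1, \<sigma> * q / \<delta>2] K * q ^ K)"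
      by (simp add: mult_ac)
    moreover have "1 / qpoch q (q / f) K = qpoch q (q / f * q ^ K) (N - K) / fN"
      using tail[OF K(1)] fN by (auto simp: field_simps)
    moreover have "P / X * R * W1 * W2 = P * (1 / X) * R * W1 * W2" for P X R by simp
    ultimately show "qpochs q [b / t, c / t, d1 / t, d2 / t, \<sigma> * q, \<epsilon>, \<phi>, q powi (- int N)] K
        / qpochs q [q, 1 / t, q / e, q / f, \<sigma> * q / \<beta>, \<sigma> * q / \<gamma>, \<sigma> * q / \<delta>1, \<sigma> * q / \<delta>2] K
        * q ^ K
        * vwp_series q (t * q powi (- int K))
            [b, c, d1, d2, e * q powi (- int K), f * q powi (- int K), q powi (- int K)]
            (t ^ 3 * q ^ 3 / (b * c * d1 * d2 * e * f))
        * vwp_series q (\<sigma> * q ^ K)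
            [\<beta>, \<gamma>, \<delta>1, \<delta>2, \<epsilon> * q ^ K, \<phi> * q ^ K, q powi (int K - int N)]
            (\<sigma> ^ 3 * q ^ (N + 3) / (\<beta> * \<gamma> * \<delta>1 * \<delta>2 * \<epsilon> * \<phi>))
        = C1 / fN * (ff K * (A ^ (N - K) * gg (N - K)))"
      unfolding fK gK Q split[OF K(1)] W1_def[symmetric] W2_def[symmetric] rc1[OF K(1)]
      by (simp only: divide_inverse mult_ac mult_1_left mult_1_right)
  qed
  have RHS: "(\<Sum>L\<le>N.
        qpochs q [t * q / (c * f), t * q / (b * f), t * q / (d1 * f), t * q / (d2 * f),
                  q powi (1 - int N) * \<phi> / \<epsilon>, q powi (- int N) * \<phi> / \<sigma>, \<phi>, q powi (- int N)] L
        / qpochs q [q, e / f, t * q / f, q / f, q powi (- int N) * \<gamma> * \<phi> / \<sigma>, q powi (- int N) * \<beta> * \<phi> / \<sigma>, q powi (- int N) * \<delta>1 * \<phi> / \<sigma>,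
                    q powi (- int N) * \<delta>2 * \<phi> / \<sigma>] L
        * q ^ L
        * vwp_series q (q powi (- int L) * f / e)
            [t * q / (c * e), t * q / (b * e), t * q / (d1 * e), t * q / (d2 * e), f * q powi (- int L) / t, f * q powi (- int L), q powi (- int L)]
            (b * c * d1 * d2 * e * f * q powi (-1) / t ^ 3)
        * vwp_series q (q powi (int L - int N) * \<phi> / \<epsilon>)
            [\<sigma> * q / (\<gamma> * \<epsilon>), \<sigma> * q / (\<beta> * \<epsilon>), \<sigma> * q / (\<delta>1 * \<epsilon>), \<sigma> * q / (\<delta>2 * \<epsilon>), q powi (int L - int N) * \<phi> / \<sigma>, q ^ L * \<phi>, q powi (int L - int N)]
            (\<beta> * \<gamma> * \<delta>1 * \<delta>2 * \<epsilon> * \<phi> * q powi (- int N - 1) / \<sigma> ^ 3))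
     = C2 / (fN * A ^ N) * (\<Sum>L\<le>N. A ^ L * ff' L * gg' (N - L))"
    unfolding sum_distrib_left
  proof (intro sum.cong refl)
    fix L assume "L \<in> {..N}"
    then have L: "L \<le> N" "N - L \<le> N" "N - (N - L) = L" by auto
    define W3 where "W3 = vwp_series q (q powi (- int L) * f / e)
            [t * q / (c * e), t * q / (b * e), t * q / (d1 * e), t * q / (d2 * e), f * q powi (- int L) / t, f * q powi (- int L), q powi (- int L)]
            (b * c * d1 * d2 * e * f * q powi (-1) / t ^ 3)"
    define W4 where "W4 = vwp_series q (q powi (- int (N - L)) * \<phi> / \<epsilon>)
            [\<sigma> * q / (\<gamma> * \<epsilon>), \<sigma> * q / (\<beta> * \<epsilon>), \<sigma> * q / (\<delta>1 * \<epsilon>), \<sigma> * q / (\<delta>2 * \<epsilon>), q powi (- int (N - L)) * \<phi> / \<sigma>, q ^ L * \<phi>, q powi (- int (N - L))]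
            (\<beta> * \<gamma> * \<delta>1 * \<delta>2 * \<epsilon> * \<phi> * q powi (- int N - 1) / \<sigma> ^ 3)"
    have q_inv: "q powi (-1) = 1 / q" "q powi (- int N - 1) = 1 / (Z * q)"
      using q by (simp_all add: power_int_diff qm Z_def power_int_minus divide_inverse)
    have W3: "vwp_series q (f / e * q powi (- int L))
        [t * q / (b * e), t * q / (c * e), t * q / (d1 * e), t * q / (d2 * e), f / t * q powi (- int L), f * q powi (- int L), q powi (- int L)]
        (b * c * d1 * d2 * e * f / (t ^ 3 * q)) = W3"
    proof -
      have s: "q powi (- int L) * f / e = f / e * q powi (- int L)" "f * q powi (- int L) / t = f / t * q powi (- int L)"
        "b * c * d1 * d2 * e * f * q powi (-1) / t ^ 3 = b * c * d1 * d2 * e * f / (t ^ 3 * q)"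
        unfolding q_inv by simp_all
      show ?thesis unfolding W3_def s by (rule vwp_series_swap)
    qed
    have W4: "vwp_series q (\<phi> * Z / (\<epsilon> * Z) * q powi - int (N - L))
        [\<sigma> * Z * q / (\<beta> * (\<epsilon> * Z)), \<sigma> * Z * q / (\<gamma> * (\<epsilon> * Z)), \<sigma> * Z * q / (\<delta>1 * (\<epsilon> * Z)), \<sigma> * Z * q / (\<delta>2 * (\<epsilon> * Z)),
         \<phi> * Z / (\<sigma> * Z) * q powi - int (N - L), \<phi> * q ^ L, q powi - int (N - L)]
        (\<beta> * \<gamma> * \<delta>1 * \<delta>2 * (\<epsilon> * Z) * (\<phi> * Z) / ((\<sigma> * Z) ^ 3 * q)) = W4"
    proof -
      have s: "\<phi> * Z / (z * Z) * y = y * \<phi> / z" "\<sigma> * Z * q / (y * (\<epsilon> * Z)) = \<sigma> * q / (y * \<epsilon>)" "\<phi> * y = y * \<phi>"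
        "\<beta> * \<gamma> * \<delta>1 * \<delta>2 * (\<epsilon> * Z) * (\<phi> * Z) / ((\<sigma> * Z) ^ 3 * q) = \<beta> * \<gamma> * \<delta>1 * \<delta>2 * \<epsilon> * \<phi> * q powi (- int N - 1) / \<sigma> ^ 3" for y z
        unfolding q_inv using Z by (simp_all add: power3_eq_cube mult_ac)
      show ?thesis unfolding W4_def s(1,2,4) s(3)[of "q ^ L"] by (rule vwp_series_swap)
    qed
    have s: "\<sigma> * Z * q / (z * (\<phi> * Z)) = \<sigma> * q / (z * \<phi>)" "\<epsilon> * Z / (\<phi> * Z) = \<epsilon> / \<phi>" "\<sigma> * Z * q / (\<phi> * Z) = \<sigma> * q / \<phi>" for z
      using Z by simp_all
    have pw: "(1 / A) ^ (N - L) = A ^ L / A ^ N"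
      using A0 L(1) by (simp add: power_divide power_diff)
    define X where "X = qpochs q [t * q / (b * f), t * q / (c * f), t * q / (d1 * f), t * q / (d2 * f)] L / qpochs q [q, e / f, t * q / f] L"
    define Y where "Y = qpochs q [\<sigma> * q / (\<beta> * \<phi>), \<sigma> * q / (\<gamma> * \<phi>), \<sigma> * q / (\<delta>1 * \<phi>), \<sigma> * q / (\<delta>2 * \<phi>)] (N - L) / qpochs q [q, \<epsilon> / \<phi>, \<sigma> * q / \<phi>] (N - L)"
    have "1 / qpoch q (q / f) L = qpoch q (q / f * q ^ L) (N - L) / fN"
      using tail[OF L(1)] fN by (auto simp: field_simps)
    moreover have "qpochs q [t * q / (c * f), t * q / (b * f), t * q / (d1 * f), t * q / (d2 * f),
                  q / Z * \<phi> / \<epsilon>, 1 / Z * \<phi> / \<sigma>, \<phi>, 1 / Z] L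
        / qpochs q [q, e / f, t * q / f, q / f, 1 / Z * \<gamma> * \<phi> / \<sigma>, 1 / Z * \<beta> * \<phi> / \<sigma>, 1 / Z * \<delta>1 * \<phi> / \<sigma>,
                    1 / Z * \<delta>2 * \<phi> / \<sigma>] L * q ^ L
        = X * (1 / qpoch q (q / f) L) *
         (qpochs q [q / Z * \<phi> / \<epsilon>, 1 / Z * \<phi> / \<sigma>, \<phi>, 1 / Z] L / qpochs q [1 / Z * \<gamma> * \<phi> / \<sigma>, 1 / Z * \<beta> * \<phi> / \<sigma>, 1 / Z * \<delta>1 * \<phi> / \<sigma>, 1 / Z * \<delta>2 * \<phi> / \<sigma>] L * q ^ L)"
      unfolding X_def qpochs_Cons qpochs_Nil
      by (simp only: divide_inverse inverse_mult_distrib mult_ac mult_1_left mult_1_right inverse_1)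
    moreover have "qpochs q [\<sigma> * q / (\<gamma> * \<phi>), \<sigma> * q / (\<beta> * \<phi>), \<sigma> * q / (\<delta>1 * \<phi>), \<sigma> * q / (\<delta>2 * \<phi>)] (N - L)
        / qpochs q [q, \<epsilon> / \<phi>, \<sigma> * q / \<phi>] (N - L) = Y"
      by (simp add: Y_def mult_ac)
    ultimately have eq: "qpochs q [t * q / (c * f), t * q / (b * f), t * q / (d1 * f), t * q / (d2 * f),
                  q / Z * \<phi> / \<epsilon>, 1 / Z * \<phi> / \<sigma>, \<phi>, 1 / Z] L
        / qpochs q [q, e / f, t * q / f, q / f, 1 / Z * \<gamma> * \<phi> / \<sigma>, 1 / Z * \<beta> * \<phi> / \<sigma>, 1 / Z * \<delta>1 * \<phi> / \<sigma>,
                    1 / Z * \<delta>2 * \<phi> / \<sigma>] L * q ^ L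
      = X * (qpoch q (q / f * q ^ L) (N - L) / fN) * (C2 * (A ^ L / A ^ N) * (Y * qpoch q (q / (\<phi> * Z) * q ^ (N - L)) L))"
      unfolding rc2[OF L(1)] pw by (simp only:)
    note fL = F(3)[OF L(1), unfolded W3, folded X_def]
    note gL = G(3)[OF L(2), unfolded comm[OF L(1)] L(3), unfolded W4, unfolded s, folded Y_def]
    show "qpochs q [t * q / (c * f), t * q / (b * f), t * q / (d1 * f), t * q / (d2 * f),
                  q powi (1 - int N) * \<phi> / \<epsilon>, q powi (- int N) * \<phi> / \<sigma>, \<phi>, q powi (- int N)] L
        / qpochs q [q, e / f, t * q / f, q / f, q powi (- int N) * \<gamma> * \<phi> / \<sigma>, q powi (- int N) * \<beta> * \<phi> / \<sigma>, q powi (- int N) * \<delta>1 * \<phi> / \<sigma>,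
                    q powi (- int N) * \<delta>2 * \<phi> / \<sigma>] L
        * q ^ L
        * vwp_series q (q powi (- int L) * f / e)
            [t * q / (c * e), t * q / (b * e), t * q / (d1 * e), t * q / (d2 * e), f * q powi (- int L) / t, f * q powi (- int L), q powi (- int L)]
            (b * c * d1 * d2 * e * f * q powi (-1) / t ^ 3)
        * vwp_series q (q powi (int L - int N) * \<phi> / \<epsilon>)
            [\<sigma> * q / (\<gamma> * \<epsilon>), \<sigma> * q / (\<beta> * \<epsilon>), \<sigma> * q / (\<delta>1 * \<epsilon>), \<sigma> * q / (\<delta>2 * \<epsilon>), q powi (int L - int N) * \<phi> / \<sigma>, q ^ L * \<phi>, q powi (int L - int N)]
            (\<beta> * \<gamma> * \<delta>1 * \<delta>2 * \<epsilon> * \<phi> * q powi (- int N - 1) / \<sigma> ^ 3)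
        = C2 / (fN * A ^ N) * (A ^ L * ff' L * gg' (N - L))"
      unfolding fL gL Q split[OF L(1)] W3_def[symmetric] W4_def[symmetric] eq
      by (simp only: divide_inverse inverse_mult_distrib inverse_inverse_eq mult_ac mult_1_left mult_1_right)
  qed
  show ?thesis
    unfolding atLeast0AtMost LHS RHS C_def[symmetric] conv[symmetric] using CC A0 fN by (simp add: field_simps)
qed

end
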